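(* Let $\mathbf{v}\in\mathbb{R}^3$ with $|\mathbf{v}|=1$ and $\lambda\in\mathbb{R}$. If $\Sigma$ is a translating $\lambda$-soliton in $\mathbb{R}^3$ with respect to $\mathbf{v}$ which is graphical (that is, $\Sigma$ is a graph over a domain of some plane of $\mathbb{R}^3$), then $\Sigma$ is strongly stable.
   Context: Let $\mathbf{v}\in\mathbb{R}^3$, $|\mathbf{v}|=1$ (the density vector), and $\phi(x)=\langle x,\mathbf{v}\rangle$. The weighted area element is $dA_\phi=e^{\phi}\,dA$. An orientable surface $\Sigma\subset\mathbb{R}^3$ with Gauss map $N$ is a translating $\lambda$-soliton with respect to $\mathbf{v}$ if its mean curvature $H$ (sum of the principal curvatures, with the sign convention $H=\mathrm{trace}(-dN)$) satisfies $H=\langle N,\mathbf{v}\rangle+\lambda$. The plane over which $\Sigma$ is a graph need not be related to $\mathbf{v}$. Stability: let $\Delta$, $\nabla$ be the Laplace-Beltrami operator and gradient of $\Sigma$, $A$ its second fundamental form, and $C_0^\infty(\Sigma)$ the space of smooth compactly supported functions on $\Sigma$ (vanishing on $\partial\Sigma$ if $\Sigma$ has boundary). For a variation of $\Sigma$ fixing the boundary with compactly supported variational field $\xi$ and normal component $u=\langle\xi,N\rangle$, the second variation of the weighted area is $Q_\phi(u)=-\int_\Sigma u(\Delta u+\langle\nabla u,\mathbf{v}\rangle+|A|^2u)\,dA_\phi=\int_\Sigma(|\nabla u|^2-|A|^2u^2)\,dA_\phi$. $\Sigma$ is strongly stable if $Q_\phi(u)\geq 0$ for every $u\in C_0^\infty(\Sigma)$.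 *)

theory Defs
  imports "HOL-Analysis.Analysis"
begin

text \<open>\<^verbatim>\<open>Ck_on k W f\<close> is meant for open \<^verbatim>\<open>W\<close>.\<close>

primrec Ck_on :: "nat \<Rightarrow> 'a::real_normed_vector set \<Rightarrow> ('a \<Rightarrow> 'b::real_normed_vector) \<Rightarrow> bool" where
  "Ck_on 0 W f \<longleftrightarrow> continuous_on W f"
| "Ck_on (Suc k) W f \<longleftrightarrow> (\<forall>x\<in>W. f differentiable (at x)) \<and>
     (\<forall>h. Ck_on k W (\<lambda>x. frechet_derivative f (at x) h))"

text \<open>Smoothness on an arbitrary subset of a Euclidean space: a smooth extension exists near
  every point of the subset.\<close>

definition smooth_on :: "'a::euclidean_space set \<Rightarrow> ('a \<Rightarrow> 'b::euclidean_space) \<Rightarrow> bool" where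
  "smooth_on A f \<longleftrightarrow> (\<forall>p\<in>A. \<exists>W g. open W \<and> p \<in> W \<and> (\<forall>k. Ck_on k W g) \<and> (\<forall>x\<in>W \<inter> A. g x = f x))"

text \<open>Surfaces are embedded in three-space and may have a boundary, so that local
  parametrizations are diffeomorphisms from relatively open subsets of a closed half-plane onto
  relatively open subsets of the surface. Interior charts are those whose domain does not meet
  the line \<^verbatim>\<open>q $ 1 = 0\<close>.\<close>

definition half_plane :: "(real^2) set" where
  "half_plane = {q. 0 \<le> q $ 1}"

definition local_param :: "(real^3) set \<Rightarrow> (real^2) set \<Rightarrow> (real^2 \<Rightarrow> real^3) \<Rightarrow> bool" where
  "local_param S U x \<longleftrightarrow>
     openin (top_of_set half_plane) U \<and> openin (top_of_set S) (x ` U) \<and> smooth_on U x \<and>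
     (\<exists>y. smooth_on (x ` U) y \<and> (\<forall>q\<in>U. y (x q) = q))"

definition surface :: "(real^3) set \<Rightarrow> bool" where
  "surface S \<longleftrightarrow> (\<forall>p\<in>S. \<exists>U x. local_param S U x \<and> p \<in> x ` U)"

definition surface_boundary :: "(real^3) set \<Rightarrow> (real^3) set" where
  "surface_boundary S = {p. \<exists>U x q. local_param S U x \<and> q \<in> U \<and> q $ 1 = 0 \<and> p = x q}"

definition tangent_space :: "(real^3) set \<Rightarrow> real^3 \<Rightarrow> (real^3) set" where
  "tangent_space S p =
     {w. \<exists>U x q. local_param S U x \<and> q \<in> U \<and> x q = p \<and>
                 w \<in> range (frechet_derivative x (at q within U))}"

text \<open>The derivative of \<^verbatim>\<open>f\<close> at \<^verbatim>\<open>p\<close> within \<^verbatim>\<open>S\<close> is determined on the tangent space only.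
  We extend it by zero on the normal line, so that it is a linear map on all of three-space.\<close>

definition surface_differential ::
    "(real^3) set \<Rightarrow> (real^3 \<Rightarrow> 'b::real_normed_vector) \<Rightarrow> real^3 \<Rightarrow> real^3 \<Rightarrow> 'b" where
  "surface_differential S f p =
     (THE D. (f has_derivative D) (at p within S) \<and>
             (\<forall>n. (\<forall>w\<in>tangent_space S p. n \<bullet> w = 0) \<longrightarrow> D n = 0))"

definition surface_gradient :: "(real^3) set \<Rightarrow> (real^3 \<Rightarrow> real) \<Rightarrow> real^3 \<Rightarrow> real^3" where
  "surface_gradient S u p =
     (THE g. g \<in> tangent_space S p \<and>
             (\<forall>w\<in>tangent_space S p. g \<bullet> w = surface_differential S u p w))"

definition gauss_map :: "(real^3) set \<Rightarrow> (real^3 \<Rightarrow> real^3) \<Rightarrow> bool" where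
  "gauss_map S N \<longleftrightarrow> smooth_on S N \<and>
     (\<forall>p\<in>S. norm (N p) = 1 \<and> (\<forall>w\<in>tangent_space S p. N p \<bullet> w = 0))"

definition shape_operator :: "(real^3) set \<Rightarrow> (real^3 \<Rightarrow> real^3) \<Rightarrow> real^3 \<Rightarrow> real^3 \<Rightarrow> real^3" where
  "shape_operator S N p w = - surface_differential S N p w"

text \<open>The shape operator takes values in the tangent space and its extension vanishes on the
  normal line. Hence its trace over three-space, and the sum of squares of its entries in an
  orthonormal basis of three-space, are those of the operator on the tangent space.\<close>

definition mean_curvature :: "(real^3) set \<Rightarrow> (real^3 \<Rightarrow> real^3) \<Rightarrow> real^3 \<Rightarrow> real" where
  "mean_curvature S N p = trace (matrix (shape_operator S N p))"

definition second_fundamental_form ::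
    "(real^3) set \<Rightarrow> (real^3 \<Rightarrow> real^3) \<Rightarrow> real^3 \<Rightarrow> real^3 \<Rightarrow> real^3 \<Rightarrow> real" where
  "second_fundamental_form S N p w z = shape_operator S N p w \<bullet> z"

definition sff_norm_sq :: "(real^3) set \<Rightarrow> (real^3 \<Rightarrow> real^3) \<Rightarrow> real^3 \<Rightarrow> real" where
  "sff_norm_sq S N p = (\<Sum>a\<in>Basis. \<Sum>b\<in>Basis. (second_fundamental_form S N p a b)\<^sup>2)"

definition translating_soliton ::
    "real^3 \<Rightarrow> real \<Rightarrow> (real^3) set \<Rightarrow> (real^3 \<Rightarrow> real^3) \<Rightarrow> bool" where
  "translating_soliton v l S N \<longleftrightarrow> surface S \<and> gauss_map S N \<and>
     (\<forall>p\<in>S. mean_curvature S N p = N p \<bullet> v + l)"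

text \<open>The Riemannian area is the Borel measure on \<^verbatim>\<open>S\<close> given by \<^verbatim>\<open>|x_1 \<times> x_2| dq\<close> in every
  local parametrization \<^verbatim>\<open>x\<close>.\<close>

definition area_measure :: "(real^3) set \<Rightarrow> (real^3) measure" where
  "area_measure S =
     (THE M. sets M = sets (restrict_space borel S) \<and>
        (\<forall>U x E. local_param S U x \<and> E \<in> sets borel \<and> E \<subseteq> U \<longrightarrow>
           emeasure M (x ` E) =
             (\<integral>\<^sup>+ q\<in>E. ennreal (norm (cross3 (frechet_derivative x (at q within U) (axis 1 1))
                                        (frechet_derivative x (at q within U) (axis 2 1)))) \<partial>lborel)))"

definition weighted_area :: "real^3 \<Rightarrow> (real^3) set \<Rightarrow> (real^3) measure" where
  "weighted_area v S = density (area_measure S) (\<lambda>p. ennreal (exp (p \<bullet> v)))"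

definition test_function :: "(real^3) set \<Rightarrow> (real^3 \<Rightarrow> real) \<Rightarrow> bool" where
  "test_function S u \<longleftrightarrow> smooth_on S u \<and>
     (\<exists>K. compact K \<and> K \<subseteq> S \<and> (\<forall>p\<in>S - K. u p = 0)) \<and>
     (\<forall>p\<in>surface_boundary S. u p = 0)"

definition second_variation ::
    "real^3 \<Rightarrow> (real^3) set \<Rightarrow> (real^3 \<Rightarrow> real^3) \<Rightarrow> (real^3 \<Rightarrow> real) \<Rightarrow> real" where
  "second_variation v S N u =
     (LINT p|weighted_area v S. (norm (surface_gradient S u p))\<^sup>2 - sff_norm_sq S N p * (u p)\<^sup>2)"

definition strongly_stable :: "real^3 \<Rightarrow> (real^3) set \<Rightarrow> (real^3 \<Rightarrow> real^3) \<Rightarrow> bool" where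
  "strongly_stable v S N \<longleftrightarrow> (\<forall>u. test_function S u \<longrightarrow> 0 \<le> second_variation v S N u)"

text \<open>The graph is taken over a domain \<^verbatim>\<open>W\<close> of the plane \<^verbatim>\<open>e \<bullet> q = c\<close>, together with those of
  its boundary points (none if \<^verbatim>\<open>D = W\<close>) over which the surface has its own boundary.\<close>

definition graphical :: "(real^3) set \<Rightarrow> bool" where
  "graphical S \<longleftrightarrow>
     (\<exists>e c W D f. norm e = 1 \<and>
        openin (top_of_set {q. e \<bullet> q = c}) W \<and> connected W \<and> W \<noteq> {} \<and>
        W \<subseteq> D \<and> D \<subseteq> closure W \<and>
        smooth_on D (f :: real^3 \<Rightarrow> real) \<and>
        S = (\<lambda>q. q + f q *\<^sub>R e) ` D)"

end

theory Submission
  imports Defs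
begin

text \<open>
  Let \<open>S\<close> be a graph over a plane with unit normal \<open>e\<close>, and let \<open>\<psi> = N \<bullet> e\<close>. The function \<open>\<psi>\<close>
  has no zeros because the tangent planes of a graph are not vertical, so after possibly replacing
  \<open>e\<close> by \<open>- e\<close> it is positive. The soliton equation \<open>H = N \<bullet> v + l\<close> is invariant under
  translations, in particular those in direction \<open>e\<close>, and \<open>\<psi>\<close> is the normal component of the
  corresponding variation. Therefore \<open>\<psi>\<close> solves the Jacobi equation
  \<open>\<Delta>\<psi> + \<langle>\<nabla>\<psi>, v\<rangle> + |A|\<^sup>2 \<psi> = 0\<close>. A positive solution of this equation forces stability: for a test
  function \<open>u\<close> the weighted divergence of \<open>u\<^sup>2 \<nabla>\<psi> / \<psi>\<close> equals
  \<open>|\<nabla>u|\<^sup>2 - |A|\<^sup>2 u\<^sup>2 - |\<nabla>u - u \<nabla>\<psi> / \<psi>|\<^sup>2\<close>, its integral is zero, and so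
  \<open>Q(u) = \<integral> |\<nabla>u - u \<nabla>\<psi> / \<psi>|\<^sup>2 \<ge> 0\<close>.

  The computation takes place in the coordinates of the graph, a parametrization
  \<open>y \<mapsto> y\<^sub>1 t1 + y\<^sub>2 t2 + h(y) e\<close> over a set \<open>\<Omega>\<close> of the coordinate plane. Multiplied by the density
  of the weighted area, the field above becomes \<open>flux\<close>, an expression in the Gauss map \<open>n\<close>, its
  first derivatives and \<open>u\<close>. The pointwise inequality between its divergence and the integrand of
  \<open>Q(u)\<close> is \<open>divergence_flux_le\<close>; the Jacobi equation enters there as the derivative of the
  soliton equation together with the symmetry of the second derivatives of \<open>n\<close>.

  The set \<open>\<Omega>\<close> includes the points below the boundary of \<open>S\<close>, near which \<open>h\<close> and \<open>n\<close> are known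
  only through local smooth extensions. Points over \<open>\<Omega> - interior \<Omega>\<close> are boundary points of \<open>S\<close>
  by invariance of domain (\<open>lift_in_boundary\<close>), so \<open>u\<close> vanishes there, and the flux, which is
  quadratic in \<open>u\<close>, vanishes together with its first derivatives. Extended by zero it is a compactly supported \<open>C\<^sup>1\<close> function
  on the whole plane (\<open>Ck_on_flux_extension\<close>), and the integrals of its partial derivatives are
  zero by translation invariance of Lebesgue measure (\<open>integral_directional_derivative_eq_0\<close>).
  At the points over \<open>\<Omega> - interior \<Omega>\<close> the integrand of \<open>Q(u)\<close> is nonnegative because \<open>u = 0\<close>.

  To compare the two integrals, the area measure of \<open>S\<close> is identified with the image of
  \<open>dy / \<psi>\<close> under the graph parametrization (\<open>area_measure_eq\<close>): this measure has the prescribed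
  values in every chart by change of variables, and those values determine a measure because
  countably many charts cover \<open>S\<close>.
\<close>

section \<open>Functions of class \<open>C\<^sup>k\<close>\<close>

lemma Ck_on_cong:
  assumes "open W" "\<And>x. x \<in> W \<Longrightarrow> f x = g x" "Ck_on k W f"
  shows "Ck_on k W g"
  using assms(2,3)
proof (induction k arbitrary: f g)
  case 0
  then show ?case by (auto cong: continuous_on_cong)
next
  case (Suc k)
  have eq: "frechet_derivative f (at x) = frechet_derivative g (at x)" if "x \<in> W" for x
    using frechet_derivative_transform_within_open[of f x W g] Suc.prems that assms(1) by auto
  have "g differentiable (at x)" if "x \<in> W" for x
  proof -
    have "f differentiable (at x)" using Suc.prems that by auto
    then obtain F where "(f has_derivative F) (at x)" by (auto simp: differentiable_def)
    then have "(g has_derivative F) (at x)"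
      using has_derivative_transform_within_open[of f F x UNIV W g] that assms(1) Suc.prems(1) by auto
    then show ?thesis by (auto simp: differentiable_def)
  qed
  moreover have "Ck_on k W (\<lambda>x. frechet_derivative g (at x) h)" for h
    by (rule Suc.IH[of "\<lambda>x. frechet_derivative f (at x) h"]) (use eq Suc.prems in auto)
  ultimately show ?case by simp
qed

lemma Ck_on_subset: "Ck_on k W f \<Longrightarrow> V \<subseteq> W \<Longrightarrow> Ck_on k V f"
  by (induction k arbitrary: f) (auto intro: continuous_on_subset)

text \<open>Together with \<open>Ck_on_cong\<close>, locality is what lets a function with smooth extensions near
  each point of a set inherit their derivatives on the interior of that set.\<close>

lemma Ck_on_local:
  assumes "\<And>x. x \<in> W \<Longrightarrow> \<exists>V. open V \<and> x \<in> V \<and> Ck_on k V f"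
  shows "Ck_on k W f"
  using assms
proof (induction k arbitrary: f)
  case 0
  have "isCont f x" if "x \<in> W" for x
    using 0[OF that] by (auto simp: continuous_on_eq_continuous_at)
  then show ?case by (simp add: continuous_at_imp_continuous_on)
next
  case (Suc k)
  have "f differentiable (at x)" if "x \<in> W" for x
    using Suc.prems[OF that] by auto
  moreover have "Ck_on k W (\<lambda>x. frechet_derivative f (at x) h)" for h
    by (rule Suc.IH) (use Suc.prems in fastforce)
  ultimately show ?case by simp
qed

lemma Ck_on_has_derivative:
  "Ck_on (Suc k) W f \<Longrightarrow> x \<in> W \<Longrightarrow> (f has_derivative frechet_derivative f (at x)) (at x)"
  by (simp add: frechet_derivative_works[symmetric])

lemma Ck_on_directional_derivative:
  "Ck_on (Suc k) W f \<Longrightarrow> Ck_on k W (\<lambda>x. frechet_derivative f (at x) h)"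
  by simp

lemma Ck_on_SucI:
  assumes "open W" "\<And>x. x \<in> W \<Longrightarrow> (f has_derivative f' x) (at x)"
    "\<And>h. Ck_on k W (\<lambda>x. f' x h)"
  shows "Ck_on (Suc k) W f"
proof -
  have "frechet_derivative f (at x) = f' x" if "x \<in> W" for x
    using frechet_derivative_at assms(2) that by metis
  then have "Ck_on k W (\<lambda>x. frechet_derivative f (at x) h)" for h
    by (intro Ck_on_cong[OF assms(1) _ assms(3)]) auto
  then show ?thesis using assms(2) by (auto simp: differentiable_def)
qed

lemma Ck_on_SucD: "Ck_on (Suc k) W f \<Longrightarrow> Ck_on k W f"
proof (induction k arbitrary: f)
  case 0
  then show ?case
    by (auto intro!: continuous_at_imp_continuous_on differentiable_imp_continuous_within)
next
  case (Suc k)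
  then show ?case by (auto simp del: Ck_on.simps(1))
qed

lemma Ck_on_continuous: "Ck_on k W f \<Longrightarrow> continuous_on W f"
  by (induction k) (auto dest: Ck_on_SucD simp del: Ck_on.simps(2))

lemma Ck_on_const: "open W \<Longrightarrow> Ck_on k W (\<lambda>x. c)"
proof (induction k arbitrary: c)
  case (Suc k)
  show ?case by (rule Ck_on_SucI[where f' = "\<lambda>_ _. 0"]) (use Suc in auto)
qed auto

lemma Ck_on_bounded_linear:
  assumes "open W" "bounded_linear f"
  shows "Ck_on k W f"
proof (cases k)
  case 0
  then show ?thesis by (simp add: assms(2) linear_continuous_on)
next
  case (Suc k)
  then show ?thesis
    using Ck_on_SucI[of W f "\<lambda>_. f" k] assms
    by (auto intro: Ck_on_const bounded_linear_imp_has_derivative)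
qed

lemma Ck_on_add:
  assumes "open W"
  shows "Ck_on k W f \<Longrightarrow> Ck_on k W g \<Longrightarrow> Ck_on k W (\<lambda>x. f x + g x)"
proof (induction k arbitrary: f g)
  case 0
  then show ?case by (auto intro: continuous_intros)
next
  case (Suc k)
  show ?case
  proof (rule Ck_on_SucI[OF assms])
    show "((\<lambda>x. f x + g x) has_derivative
        (\<lambda>h. frechet_derivative f (at x) h + frechet_derivative g (at x) h)) (at x)" if "x \<in> W" for x
      by (intro has_derivative_add Ck_on_has_derivative[OF _ that]) (use Suc in auto)
    show "Ck_on k W (\<lambda>x. frechet_derivative f (at x) h + frechet_derivative g (at x) h)" for h
      by (intro Suc.IH) (use Suc in auto)
  qed
qed

lemma Ck_on_sum:
  assumes "open W" "\<And>i. i \<in> I \<Longrightarrow> Ck_on k W (f i)"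
  shows "Ck_on k W (\<lambda>x. \<Sum>i\<in>I. f i x)"
  using assms by (induction I rule: infinite_finite_induct) (auto intro: Ck_on_const Ck_on_add)

lemma Ck_on_bilinear:
  assumes "open W" and bil: "bounded_bilinear pr"
  shows "Ck_on k W f \<Longrightarrow> Ck_on k W g \<Longrightarrow> Ck_on k W (\<lambda>x. pr (f x) (g x))"
proof (induction k arbitrary: f g)
  case 0
  then show ?case by (auto intro: bounded_bilinear.continuous_on[OF bil])
next
  case (Suc k)
  show ?case
  proof (rule Ck_on_SucI[OF assms(1)])
    show "((\<lambda>x. pr (f x) (g x)) has_derivative
        (\<lambda>h. pr (f x) (frechet_derivative g (at x) h) + pr (frechet_derivative f (at x) h) (g x))) (at x)"
      if "x \<in> W" for x
      by (intro bounded_bilinear.FDERIV[OF bil] Ck_on_has_derivative[OF _ that]) (use Suc in auto)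
    show "Ck_on k W (\<lambda>x. pr (f x) (frechet_derivative g (at x) h) +
        pr (frechet_derivative f (at x) h) (g x))" for h
      by (intro Ck_on_add assms Suc.IH) (use Suc in \<open>auto dest: Ck_on_SucD simp del: Ck_on.simps\<close>,
          (use Suc in auto)[2])
  qed
qed

lemmas Ck_on_mult = Ck_on_bilinear[OF _ bounded_bilinear_mult]
lemmas Ck_on_scaleR = Ck_on_bilinear[OF _ bounded_bilinear_scaleR]
lemmas Ck_on_inner = Ck_on_bilinear[OF _ bounded_bilinear_inner]

lemma Ck_on_minus:
  "open W \<Longrightarrow> Ck_on k W f \<Longrightarrow> Ck_on k W (\<lambda>x. - f x)"
  using Ck_on_scaleR[of W k "\<lambda>_. -1" f] by (simp add: Ck_on_const)

text \<open>The chain rule writes the derivative of the composite as a sum of products of \<open>C\<^sup>k\<close>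
  functions once the inner derivative is expanded in a basis; this is why the middle space is
  Euclidean.\<close>

lemma Ck_on_compose:
  fixes f :: "'b::euclidean_space \<Rightarrow> 'c::real_normed_vector"
  assumes "open V" "open W"
  shows "Ck_on k W f \<Longrightarrow> Ck_on k V g \<Longrightarrow> g ` V \<subseteq> W \<Longrightarrow> Ck_on k V (\<lambda>x. f (g x))"
proof (induction k arbitrary: f)
  case 0
  then show ?case by (auto intro: continuous_on_compose2)
next
  case (Suc k)
  let ?f' = "\<lambda>x. frechet_derivative f (at x)" and ?g' = "\<lambda>x. frechet_derivative g (at x)"
  show ?case
  proof (rule Ck_on_SucI[OF assms(1)])
    have der: "(f has_derivative ?f' (g x)) (at (g x))" "(g has_derivative ?g' x) (at x)"
      if "x \<in> V" for x
      using Suc.prems that Ck_on_has_derivative by blast+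
    show "((\<lambda>x. f (g x)) has_derivative
        (\<lambda>h. \<Sum>b\<in>Basis. (?g' x h \<bullet> b) *\<^sub>R ?f' (g x) b)) (at x)" if "x \<in> V" for x
    proof -
      have lin: "linear (?f' (g x))" using der(1)[OF that] has_derivative_linear by blast
      have "?f' (g x) (?g' x h) = (\<Sum>b\<in>Basis. (?g' x h \<bullet> b) *\<^sub>R ?f' (g x) b)" for h
        by (subst euclidean_representation[symmetric])
          (simp add: linear_sum[OF lin] linear_scale[OF lin])
      then show ?thesis
        using has_derivative_compose[OF der(2)[OF that] der(1)[OF that]] by simp
    qed
    have "Ck_on k V g" using Suc.prems Ck_on_SucD by blast
    then show "Ck_on k V (\<lambda>x. \<Sum>b\<in>Basis. (?g' x h \<bullet> b) *\<^sub>R ?f' (g x) b)" for h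
      using Suc.prems
      by (intro Ck_on_sum Ck_on_scaleR Ck_on_inner Ck_on_const assms Suc.IH[of "\<lambda>x. ?f' x _"]) auto
  qed
qed

lemma Ck_on_exp: "Ck_on k UNIV (exp :: real \<Rightarrow> real)"
proof (induction k)
  case (Suc k)
  show ?case
  proof (rule Ck_on_SucI)
    show "(exp has_derivative (\<lambda>h. h * exp x)) (at x)" for x :: real
      by (auto intro!: derivative_eq_intros)
      show "Ck_on k UNIV (\<lambda>x::real. h * exp x)" for h
      by (intro Ck_on_mult Ck_on_const Suc open_UNIV)
  qed auto
qed (auto intro: continuous_intros)

lemma Ck_on_inverse: "Ck_on k (- {0}) (inverse :: real \<Rightarrow> real)"
proof (induction k)
  case 0
  then show ?case by (auto intro: continuous_intros)
next
  case (Suc k)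
  show ?case
  proof (rule Ck_on_SucI)
    show "(inverse has_derivative (\<lambda>h. - (inverse x * h * inverse x))) (at x)"
      if "x \<in> - {0}" for x :: real
      using that by (auto intro!: derivative_eq_intros)
  qed (auto intro!: Ck_on_minus Ck_on_mult Ck_on_const Suc open_Compl)
qed

section \<open>Symmetry of second derivatives\<close>

text \<open>The mean value theorem is applied twice, first to \<open>s \<mapsto> f (x + t k + s h) - f (x + s h)\<close>
  and then in direction \<open>k\<close> to its derivative. The second difference on the left is symmetric
  in \<open>h\<close> and \<open>k\<close>, the right-hand side is not: this is where symmetry of second derivatives
  comes from.\<close>

lemma second_difference_eq_second_derivative:
  fixes f :: "'a::real_normed_vector \<Rightarrow> real"
  assumes f: "Ck_on 2 (ball x r) f" and t: "0 < t" "t * (norm h + norm k) < r"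
  obtains a b where "x + a *\<^sub>R h + b *\<^sub>R k \<in> ball x r"
    "f (x + t *\<^sub>R h + t *\<^sub>R k) - f (x + t *\<^sub>R h) - f (x + t *\<^sub>R k) + f x =
      t\<^sup>2 * frechet_derivative (\<lambda>x. frechet_derivative f (at x) h) (at (x + a *\<^sub>R h + b *\<^sub>R k)) k"
proof -
  let ?f' = "\<lambda>y. frechet_derivative f (at y)"
  let ?g' = "\<lambda>y. frechet_derivative (\<lambda>x. ?f' x h) (at y)"
  have f1: "Ck_on (Suc 1) (ball x r) f" and f2: "Ck_on (Suc 0) (ball x r) (\<lambda>x. ?f' x h)"
    using f by (simp_all add: numeral_2_eq_2)
  have inb: "x + a *\<^sub>R h + b *\<^sub>R k \<in> ball x r" if "0 \<le> a" "a \<le> t" "0 \<le> b" "b \<le> t" for a b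
  proof -
    have "norm (a *\<^sub>R h + b *\<^sub>R k) \<le> a * norm h + b * norm k"
      using that norm_triangle_ineq[of "a *\<^sub>R h" "b *\<^sub>R k"] by simp
    also have "\<dots> \<le> t * norm h + t * norm k"
      using that by (intro add_mono mult_right_mono) auto
    also have "\<dots> < r" using t by (simp add: algebra_simps)
    finally show ?thesis by (metis add.assoc add_diff_cancel_left' dist_commute dist_norm mem_ball)
  qed
  have der: "((\<lambda>s. F (y + s *\<^sub>R v)) has_real_derivative F' v) (at s)"
    if "(F has_derivative F') (at (y + s *\<^sub>R v))" for F :: "'a \<Rightarrow> real" and F' y v and s :: real
  proof -
    have "((\<lambda>s. y + s *\<^sub>R v) has_derivative (\<lambda>c. c *\<^sub>R v)) (at s)"
      by (auto intro!: derivative_eq_intros)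
    from has_derivative_compose[OF this that] 
    have "((\<lambda>s. F (y + s *\<^sub>R v)) has_derivative (\<lambda>c. F' (c *\<^sub>R v))) (at s)" .
    moreover have "(\<lambda>c. F' (c *\<^sub>R v)) = (*) (F' v)"
      using linear_scale[OF has_derivative_linear[OF that]] by (auto simp: fun_eq_iff)
    ultimately show ?thesis by (simp add: has_field_derivative_def)
  qed
  define \<phi> where "\<phi> s = f (x + t *\<^sub>R k + s *\<^sub>R h) - f (x + s *\<^sub>R h)" for s
  have "(\<phi> has_real_derivative ?f' (x + t *\<^sub>R k + s *\<^sub>R h) h - ?f' (x + s *\<^sub>R h) h) (at s)"
    if "0 \<le> s" "s \<le> t" for s
    unfolding \<phi>_def
    by (intro DERIV_diff der Ck_on_has_derivative[OF f1])
      (use inb[of s t] inb[of s 0] that t in \<open>auto simp: algebra_simps\<close>)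
  from MVT2[OF t(1) this] obtain a where a: "0 < a" "a < t"
    "\<phi> t - \<phi> 0 = (t - 0) * (?f' (x + t *\<^sub>R k + a *\<^sub>R h) h - ?f' (x + a *\<^sub>R h) h)" by blast
  have "((\<lambda>s. ?f' (x + a *\<^sub>R h + s *\<^sub>R k) h) has_real_derivative ?g' (x + a *\<^sub>R h + s *\<^sub>R k) k) (at s)"
    if "0 \<le> s" "s \<le> t" for s
    by (rule der[of "\<lambda>x. ?f' x h"], rule Ck_on_has_derivative[OF f2])
      (use inb[of a s] that a in auto)
  from MVT2[OF t(1) this] obtain b where b: "0 < b" "b < t"
    "?f' (x + a *\<^sub>R h + t *\<^sub>R k) h - ?f' (x + a *\<^sub>R h + 0 *\<^sub>R k) h =
       (t - 0) * ?g' (x + a *\<^sub>R h + b *\<^sub>R k) k" by blast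
  have "\<phi> t - \<phi> 0 = t\<^sup>2 * ?g' (x + a *\<^sub>R h + b *\<^sub>R k) k"
    using a(3) b(3) by (simp add: power2_eq_square add.assoc add.commute[of "t *\<^sub>R k"])
  then show thesis
    by (intro that[OF inb[of a b]]) (use a b in simp, use a b in simp, use a b in simp, use a b in simp, simp add: \<phi>_def algebra_simps)
qed

lemma Ck_on_second_derivative_symmetric:
  fixes f :: "'a::real_normed_vector \<Rightarrow> real"
  assumes W: "open W" "x \<in> W" and f: "Ck_on 2 W f"
  shows "frechet_derivative (\<lambda>x. frechet_derivative f (at x) h) (at x) k =
    frechet_derivative (\<lambda>x. frechet_derivative f (at x) k) (at x) h"
proof -
  define g where "g h k y = frechet_derivative (\<lambda>x. frechet_derivative f (at x) h) (at y) k" for h k y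
  have cont: "continuous_on W (g h k)" for h k
    using f by (simp add: numeral_2_eq_2 g_def)
  have "\<bar>g h k x - g k h x\<bar> \<le> e" if "e > 0" for e
  proof -
    have "\<exists>d>0. \<forall>y. dist y x < d \<longrightarrow> dist (g h k y) (g h k x) < e / 2" for h k
      using cont W that half_gt_zero
      by (metis continuous_on_eq_continuous_at continuous_at_eps_delta)
    then obtain d1 d2 where d: "d1 > 0" "d2 > 0"
      "\<And>y. dist y x < d1 \<Longrightarrow> dist (g h k y) (g h k x) < e / 2"
      "\<And>y. dist y x < d2 \<Longrightarrow> dist (g k h y) (g k h x) < e / 2" by metis
    obtain d3 where d3: "d3 > 0" "ball x d3 \<subseteq> W" using W openE by blast
    define r where "r = min d3 (min d1 d2)"
    have r: "r > 0" using d d3 by (simp add: r_def)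
    have fr: "Ck_on 2 (ball x r) f"
      by (rule Ck_on_subset[OF f]) (use d3 in \<open>auto simp: r_def\<close>)
    define t where "t = r / (2 * (norm h + norm k + 1))"
    have t: "t > 0" "t * (norm h + norm k) < r" "t * (norm k + norm h) < r"
      using r by (auto simp: t_def divide_simps add_nonneg_pos pos_less_divide_eq)
    have comm: "x + t *\<^sub>R k + t *\<^sub>R h = x + t *\<^sub>R h + t *\<^sub>R k" by simp
    obtain y where y: "y \<in> ball x r"
      "f (x + t *\<^sub>R h + t *\<^sub>R k) - f (x + t *\<^sub>R h) - f (x + t *\<^sub>R k) + f x = t\<^sup>2 * g h k y"
      using second_difference_eq_second_derivative[OF fr t(1,2)] unfolding g_def by metis
    obtain z where z: "z \<in> ball x r"
      "f (x + t *\<^sub>R h + t *\<^sub>R k) - f (x + t *\<^sub>R k) - f (x + t *\<^sub>R h) + f x = t\<^sup>2 * g k h z"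
      using second_difference_eq_second_derivative[OF fr t(1,3)] unfolding g_def comm by metis
    have "t\<^sup>2 * g h k y = t\<^sup>2 * g k h z" using y(2) z(2) by linarith
    then have "g h k y = g k h z" using t by simp
    moreover have "dist (g h k y) (g h k x) < e / 2" "dist (g k h z) (g k h x) < e / 2"
      using d(3)[of y] d(4)[of z] y(1) z(1) by (auto simp: r_def dist_commute[of x])
    ultimately show ?thesis unfolding dist_real_def by linarith
  qed
  then have "g h k x = g k h x"
    using field_le_epsilon[of "\<bar>g h k x - g k h x\<bar>" 0] by auto
  then show ?thesis by (simp add: g_def)
qed

lemma Ck_on_second_derivative_symmetric_inner:
  fixes f :: "'a::real_normed_vector \<Rightarrow> 'b::real_inner"
  assumes W: "open W" "x \<in> W" and f: "Ck_on 2 W f"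
  shows "frechet_derivative (\<lambda>x. frechet_derivative f (at x) h) (at x) k =
    frechet_derivative (\<lambda>x. frechet_derivative f (at x) k) (at x) h"
proof -
  have f1: "Ck_on (Suc 1) W f" using f by (simp add: numeral_2_eq_2)
  have f2: "Ck_on (Suc 0) W (\<lambda>x. frechet_derivative f (at x) h)" for h
    using f by (simp add: numeral_2_eq_2)
  have "frechet_derivative (\<lambda>x. frechet_derivative (\<lambda>x. f x \<bullet> c) (at x) h) (at x) k =
    frechet_derivative (\<lambda>x. frechet_derivative f (at x) h) (at x) k \<bullet> c" for c h k
  proof -
    have 1: "frechet_derivative (\<lambda>x. f x \<bullet> c) (at y) h = frechet_derivative f (at y) h \<bullet> c" if "y \<in> W" for y
      using frechet_derivative_at[OF has_derivative_inner_left[OF Ck_on_has_derivative[OF f1 that], of c]]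
      by (metis)
    have d: "((\<lambda>x. frechet_derivative f (at x) h \<bullet> c) has_derivative
        (\<lambda>k. frechet_derivative (\<lambda>x. frechet_derivative f (at x) h) (at x) k \<bullet> c)) (at x)"
      by (rule has_derivative_inner_left[OF Ck_on_has_derivative[OF f2 W(2)]])
    have "((\<lambda>x. frechet_derivative (\<lambda>x. f x \<bullet> c) (at x) h) has_derivative
        (\<lambda>k. frechet_derivative (\<lambda>x. frechet_derivative f (at x) h) (at x) k \<bullet> c)) (at x)"
      by (rule has_derivative_transform_within_open[OF d W]) (simp add: 1)
    from frechet_derivative_at[OF this] show ?thesis by metis
  qed
  moreover have "Ck_on 2 W (\<lambda>x. f x \<bullet> c)" for c
    by (rule Ck_on_inner[OF W(1) f Ck_on_const[OF W(1)]])
  ultimately have "frechet_derivative (\<lambda>x. frechet_derivative f (at x) h) (at x) k \<bullet> c =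
    frechet_derivative (\<lambda>x. frechet_derivative f (at x) k) (at x) h \<bullet> c" for c
    using Ck_on_second_derivative_symmetric[OF W, of "\<lambda>x. f x \<bullet> c" h k] by metis
  then show ?thesis using vector_eq_rdot by blast
qed

section \<open>Smooth functions on arbitrary sets\<close>

lemma smooth_onE:
  assumes "smooth_on A f" "p \<in> A"
  obtains W g where "open W" "p \<in> W" "\<And>k. Ck_on k W g" "\<And>x. x \<in> W \<inter> A \<Longrightarrow> g x = f x"
proof -
  have "\<exists>W g. open W \<and> p \<in> W \<and> (\<forall>k. Ck_on k W g) \<and> (\<forall>x\<in>W \<inter> A. g x = f x)"
    using assms by (simp add: smooth_on_def)
  then obtain W g where "open W" "p \<in> W" "\<forall>k. Ck_on k W g" "\<forall>x\<in>W \<inter> A. g x = f x" by blast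
  then show thesis using that[of W g] by blast
qed

lemma smooth_on_imp_Ck_on_interior:
  assumes "smooth_on A f"
  shows "Ck_on k (interior A) f"
proof (rule Ck_on_local)
  fix x assume x: "x \<in> interior A"
  then obtain W g where W: "open W" "x \<in> W" "\<And>k. Ck_on k W g" "\<And>y. y \<in> W \<inter> A \<Longrightarrow> g y = f y"
    using smooth_onE[OF assms] interior_subset by (metis subsetD)
  have "Ck_on k (W \<inter> interior A) f"
    by (rule Ck_on_cong[of _ g]) (use W interior_subset in \<open>auto intro: Ck_on_subset[OF W(3)[of k]]\<close>)
  then show "\<exists>V. open V \<and> x \<in> V \<and> Ck_on k V f"
    using W x by (intro exI[of _ "W \<inter> interior A"]) auto
qed

lemma smooth_on_imp_continuous_on:
  assumes "smooth_on A f"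
  shows "continuous_on A f"
  unfolding continuous_on_eq_continuous_within
proof
  fix x assume x: "x \<in> A"
  then obtain W g where W: "open W" "x \<in> W" "\<And>k. Ck_on k W g" "\<And>y. y \<in> W \<inter> A \<Longrightarrow> g y = f y"
    using smooth_onE[OF assms] by metis
  have "isCont g x"
    using Ck_on_continuous[OF W(3)] W by (simp add: continuous_on_eq_continuous_at)
  then have "continuous (at x within A) g" by (rule continuous_at_imp_continuous_at_within)
  moreover obtain e where "e > 0" "ball x e \<subseteq> W" using W openE by blast
  ultimately show "continuous (at x within A) f"
    by (intro continuous_transform_within[of x A g e f]) (use x W in \<open>auto simp: dist_commute subset_eq\<close>)
qed

lemma smooth_on_if_Ck_on: "open W \<Longrightarrow> (\<And>k. Ck_on k W f) \<Longrightarrow> A \<subseteq> W \<Longrightarrow> smooth_on A f"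
  unfolding smooth_on_def by (intro ballI exI[of _ W] exI[of _ f]) auto

lemma smooth_on_compose:
  assumes f: "smooth_on B f" and g: "smooth_on A g" and AB: "g ` A \<subseteq> B"
  shows "smooth_on A (\<lambda>x. f (g x))"
  unfolding smooth_on_def
proof
  fix p assume p: "p \<in> A"
  obtain W g' where W: "open W" "p \<in> W" "\<And>k. Ck_on k W g'" "\<And>y. y \<in> W \<inter> A \<Longrightarrow> g' y = g y"
    using smooth_onE[OF g p] by metis
  obtain V f' where V: "open V" "g p \<in> V" "\<And>k. Ck_on k V f'" "\<And>y. y \<in> V \<inter> B \<Longrightarrow> f' y = f y"
    using smooth_onE[OF f, of "g p"] p AB by (metis image_subset_iff)
  define U where "U = W \<inter> g' -` V"
  have U: "open U" unfolding U_def
    using continuous_on_open_vimage[OF W(1)] Ck_on_continuous[OF W(3)] V(1)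
    by (metis inf_commute)
  have "Ck_on k U (\<lambda>x. f' (g' x))" for k
    by (rule Ck_on_compose[OF U V(1) V(3)]) (auto simp: U_def intro: Ck_on_subset[OF W(3)])
  then show "\<exists>W h. open W \<and> p \<in> W \<and> (\<forall>k. Ck_on k W h) \<and> (\<forall>x\<in>W \<inter> A. h x = f (g x))"
    using U W V p AB
    by (intro exI[of _ U] exI[of _ "\<lambda>x. f' (g' x)"]) (auto simp: U_def image_subset_iff)
qed

lemma smooth_on_bilinear:
  fixes pr :: "'b::euclidean_space \<Rightarrow> 'c::euclidean_space \<Rightarrow> 'd::euclidean_space"
  assumes f: "smooth_on A f" and g: "smooth_on A g" and bil: "bounded_bilinear pr"
  shows "smooth_on A (\<lambda>x. pr (f x) (g x))"
  unfolding smooth_on_def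
proof
  fix p assume p: "p \<in> A"
  obtain W g' where W: "open W" "p \<in> W" "\<And>k. Ck_on k W g'" "\<And>y. y \<in> W \<inter> A \<Longrightarrow> g' y = g y"
    using smooth_onE[OF g p] by metis
  obtain V f' where V: "open V" "p \<in> V" "\<And>k. Ck_on k V f'" "\<And>y. y \<in> V \<inter> A \<Longrightarrow> f' y = f y"
    using smooth_onE[OF f p] by metis
  have "Ck_on k (W \<inter> V) (\<lambda>x. pr (f' x) (g' x))" for k
    by (rule Ck_on_bilinear[OF _ bil]) (use W V in \<open>auto intro: Ck_on_subset\<close>)
  then show "\<exists>W h. open W \<and> p \<in> W \<and> (\<forall>k. Ck_on k W h) \<and> (\<forall>x\<in>W \<inter> A. h x = pr (f x) (g x))"
    using W V by (intro exI[of _ "W \<inter> V"] exI[of _ "\<lambda>x. pr (f' x) (g' x)"]) auto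
qed

lemma smooth_on_add:
  assumes f: "smooth_on A f" and g: "smooth_on A g"
  shows "smooth_on A (\<lambda>x. f x + g x)"
  unfolding smooth_on_def
proof
  fix p assume p: "p \<in> A"
  obtain W g' where W: "open W" "p \<in> W" "\<And>k. Ck_on k W g'" "\<And>y. y \<in> W \<inter> A \<Longrightarrow> g' y = g y"
    using smooth_onE[OF g p] by metis
  obtain V f' where V: "open V" "p \<in> V" "\<And>k. Ck_on k V f'" "\<And>y. y \<in> V \<inter> A \<Longrightarrow> f' y = f y"
    using smooth_onE[OF f p] by metis
  have "Ck_on k (W \<inter> V) (\<lambda>x. f' x + g' x)" for k
    by (rule Ck_on_add) (use W V in \<open>auto intro: Ck_on_subset\<close>)
  then show "\<exists>W h. open W \<and> p \<in> W \<and> (\<forall>k. Ck_on k W h) \<and> (\<forall>x\<in>W \<inter> A. h x = f x + g x)"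
    using W V by (intro exI[of _ "W \<inter> V"] exI[of _ "\<lambda>x. f' x + g' x"]) auto
qed

section \<open>Extension by zero and integrals of derivatives\<close>

text \<open>If near each point of the complement of \<open>Q\<close> the function agrees on \<open>Q\<close> with some \<open>C\<^sup>1\<close>
  function that vanishes at the point together with its derivative, then that function dominates
  the extension by zero, and its derivative dominates the derivative of the extension.\<close>

lemma Ck_on_1_extension_by_zero:
  fixes F :: "'a::real_normed_vector \<Rightarrow> real"
  assumes O: "open Q" "Ck_on (Suc 0) Q F" and F0: "\<And>x. x \<notin> Q \<Longrightarrow> F x = 0"
    and near: "\<And>x. x \<notin> Q \<Longrightarrow> \<exists>V g. open V \<and> x \<in> V \<and> Ck_on (Suc 0) V g \<and> g x = 0 \<and>
      (\<forall>h. frechet_derivative g (at x) h = 0) \<and> (\<forall>y\<in>V \<inter> Q. F y = g y)"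
  shows "Ck_on (Suc 0) UNIV F" "x \<notin> Q \<Longrightarrow> frechet_derivative F (at x) h = 0"
proof -
  have der0: "(F has_derivative (\<lambda>_. 0)) (at x)" if x: "x \<notin> Q" for x
  proof -
    obtain V g where V: "open V" "x \<in> V" "Ck_on (Suc 0) V g" "g x = 0"
      "\<And>h. frechet_derivative g (at x) h = 0" "\<And>y. y \<in> V \<inter> Q \<Longrightarrow> F y = g y"
      using near[OF x] by blast
    have "(g has_derivative (\<lambda>_. 0)) (at x)"
    proof -
      have "frechet_derivative g (at x) = (\<lambda>_. 0)" using V(5) by auto
      then show ?thesis using Ck_on_has_derivative[OF V(3,2)] by simp
    qed
    moreover obtain r where r: "r > 0" "ball x r \<subseteq> V" using V openE by blast
    ultimately have g: "\<exists>d>0. \<forall>y. norm (y - x) < d \<longrightarrow> norm (g y) \<le> e * norm (y - x)" if "e > 0" for e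
      using that V(4) unfolding has_derivative_at_alt by auto
    have "\<exists>d>0. \<forall>y. norm (y - x) < d \<longrightarrow> norm (F y) \<le> e * norm (y - x)" if e: "e > 0" for e
    proof -
      obtain d where d: "d > 0" "\<And>y. norm (y - x) < d \<Longrightarrow> norm (g y) \<le> e * norm (y - x)"
        using g[OF e] by blast
      have "norm (F y) \<le> e * norm (y - x)" if "norm (y - x) < min d r" for y
      proof (cases "y \<in> Q")
        case True
        have "y \<in> V" using r that by (auto simp: dist_norm norm_minus_commute)
        then show ?thesis using d(2)[of y] V(6)[of y] that True by simp
      qed (use F0 e in auto)
      then show ?thesis using d r by (intro exI[of _ "min d r"]) auto
    qed
    then show ?thesis using F0[OF x] unfolding has_derivative_at_alt by auto
  qed
  have fd0: "frechet_derivative F (at x) h = 0" if "x \<notin> Q" for x h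
    using frechet_derivative_at[OF der0[OF that]] by metis
  then show "x \<notin> Q \<Longrightarrow> frechet_derivative F (at x) h = 0" .
  have "F differentiable (at x)" for x
    using O(2) der0[of x] by (cases "x \<in> Q") (auto simp: differentiable_def)
  moreover have "isCont (\<lambda>x. frechet_derivative F (at x) h) x" for x h
  proof (cases "x \<in> Q")
    case True
    then show ?thesis using O by (simp add: continuous_on_eq_continuous_at)
  next
    case False
    obtain V g where V: "open V" "x \<in> V" "Ck_on (Suc 0) V g" "g x = 0"
      "\<And>h. frechet_derivative g (at x) h = 0" "\<And>y. y \<in> V \<inter> Q \<Longrightarrow> F y = g y"
      using near[OF False] by blast
    have le: "norm (frechet_derivative F (at y) h) \<le> norm (frechet_derivative g (at y) h)"
      if "y \<in> V" for y
    proof (cases "y \<in> Q")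
      case True
      have "frechet_derivative F (at y) = frechet_derivative g (at y)"
        by (rule frechet_derivative_transform_within_open[of F y "V \<inter> Q" g])
          (use O V True that in auto)
      then show ?thesis by simp
    qed (simp add: fd0)
    have "isCont (\<lambda>y. frechet_derivative g (at y) h) x"
      using V(1-3) by (simp add: continuous_on_eq_continuous_at)
    then have "((\<lambda>y. frechet_derivative g (at y) h) \<longlongrightarrow> 0) (at x)"
      unfolding isCont_def V(5) .
    then have lim: "((\<lambda>y. norm (frechet_derivative g (at y) h)) \<longlongrightarrow> 0) (at x)"
      by (rule tendsto_norm_zero)
    have "eventually (\<lambda>y. y \<in> V) (at x)"
      using V(1,2) by (simp add: eventually_at_in_open')
    then have "eventually (\<lambda>y. norm (frechet_derivative F (at y) h) \<le>
        norm (frechet_derivative g (at y) h)) (at x)"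
      by (rule eventually_mono) (rule le)
    then have "((\<lambda>y. frechet_derivative F (at y) h) \<longlongrightarrow> 0) (at x)"
      by (rule Lim_null_comparison[OF _ lim])
    then show ?thesis using fd0[OF False] by (simp add: isCont_def)
  qed
  ultimately show "Ck_on (Suc 0) UNIV F"
    by (auto simp: continuous_on_eq_continuous_at)
qed

text \<open>This is the divergence theorem for compactly supported fields. The integral of the difference
  quotient \<open>(f (x + t h) - f x) / t\<close> is zero because Lebesgue measure is translation
  invariant, and dominated convergence passes to the limit \<open>t \<rightarrow> 0\<close>.\<close>

lemma
  fixes f :: "'a::euclidean_space \<Rightarrow> real"
  assumes f: "Ck_on (Suc 0) UNIV f" and K: "compact K" "\<And>x. x \<notin> K \<Longrightarrow> f x = 0"
  shows integrable_directional_derivative: "integrable lborel (\<lambda>x. frechet_derivative f (at x) h)"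
    and integral_directional_derivative_eq_0: "(LINT x|lborel. frechet_derivative f (at x) h) = 0"
proof -
  let ?D = "\<lambda>x. frechet_derivative f (at x) h"
  have contD: "continuous_on UNIV ?D" and contf: "continuous_on UNIV f"
    using f Ck_on_continuous[OF f] by auto
  have D0: "?D x = 0" if "x \<notin> K" for x
  proof -
    have "frechet_derivative f (at x) = frechet_derivative (\<lambda>_. 0) (at x)"
      by (rule frechet_derivative_transform_within_open[of f x "- K"])
        (use f K that in \<open>auto intro: open_Compl compact_imp_closed\<close>)
    then show ?thesis by simp
  qed
  have int: "integrable lborel g" if "continuous_on UNIV g" "\<And>x. x \<notin> K \<Longrightarrow> g x = 0" for g :: "'a \<Rightarrow> real"
  proof -
    have "(\<lambda>x. indicator K x *\<^sub>R g x) = g" using that(2) by (auto simp: indicator_def fun_eq_iff)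
    then show ?thesis using borel_integrable_compact[OF K(1) continuous_on_subset[OF that(1)], of] by simp
  qed
  show intD: "integrable lborel ?D" by (rule int[OF contD D0])
  have intf: "integrable lborel f" by (rule int[OF contf K(2)])
  have "compact (?D ` K)" using K contD by (intro compact_continuous_image) (auto intro: continuous_on_subset)
  then have "bounded (?D ` K)" by (rule compact_imp_bounded)
  then obtain C where "\<forall>y\<in>?D ` K. norm y \<le> C" unfolding bounded_iff by (elim exE)
  then have "\<bar>?D x\<bar> \<le> C" if "x \<in> K" for x using that by auto
  then have "\<bar>?D x\<bar> \<le> max 0 C" for x
    by (cases "x \<in> K") (use D0 in \<open>auto simp: le_max_iff_disj\<close>)
  then obtain C where C: "C \<ge> 0" "\<And>x. \<bar>?D x\<bar> \<le> C" using that[of "max 0 C"] by simp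
  obtain R where R: "\<And>x. x \<in> K \<Longrightarrow> norm x \<le> R"
    using compact_imp_bounded[OF K(1)] bounded_iff[of K] by auto
  define t where "t n = inverse (real (Suc n))" for n
  have t: "0 < t n" "t n \<le> 1" for n by (auto simp: t_def field_simps)
  define s where "s n x = (f (t n *\<^sub>R h + x) - f x) / t n" for n x
  have der: "((\<lambda>r. f (r *\<^sub>R h + x)) has_real_derivative ?D (a *\<^sub>R h + x)) (at a)" for a x
  proof -
    have 1: "((\<lambda>s. s *\<^sub>R h + x) has_derivative (\<lambda>c. c *\<^sub>R h)) (at a)"
      by (auto intro!: derivative_eq_intros)
    have 2: "(f has_derivative frechet_derivative f (at (a *\<^sub>R h + x))) (at (a *\<^sub>R h + x))"
      using Ck_on_has_derivative[OF f] by blast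
    have "(\<lambda>c. frechet_derivative f (at (a *\<^sub>R h + x)) (c *\<^sub>R h)) = (*) (?D (a *\<^sub>R h + x))"
      using linear_scale[OF has_derivative_linear[OF 2]] by (auto simp: fun_eq_iff)
    then show ?thesis using has_derivative_compose[OF 1 2] by (simp add: has_field_derivative_def)
  qed
  have lim: "(\<lambda>n. s n x) \<longlonglongrightarrow> ?D x" for x
  proof -
    have "((\<lambda>r. (f (r *\<^sub>R h + x) - f x) / r) \<longlongrightarrow> ?D x) (at 0)"
      using der[of x 0] by (simp add: has_field_derivative_iff)
    moreover have "t \<longlonglongrightarrow> 0" unfolding t_def by (rule LIMSEQ_inverse_real_of_nat)
    then have "filterlim t (at 0) sequentially"
      unfolding filterlim_at by (simp add: t_def)
    ultimately show ?thesis unfolding s_def by (rule filterlim_compose)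
  qed
  have bound: "norm (s n x) \<le> C * indicator (cball 0 (R + norm h)) x" for n x
  proof (cases "x \<in> cball 0 (R + norm h)")
    case True
    have "\<exists>z>0. z < t n \<and> f (t n *\<^sub>R h + x) - f (0 *\<^sub>R h + x) = (t n - 0) * ?D (z *\<^sub>R h + x)"
      by (rule MVT2[OF t(1)]) (rule der)
    then obtain z where "f (t n *\<^sub>R h + x) - f (0 *\<^sub>R h + x) = (t n - 0) * ?D (z *\<^sub>R h + x)"
      by blast
    then show ?thesis using True C(2)[of "z *\<^sub>R h + x"] t(1)[of n] by (simp add: s_def)
  next
    case False
    have "norm (t n *\<^sub>R h) \<le> norm h" using t[of n] by (simp add: mult_left_le_one_le)
    then have "R < norm (t n *\<^sub>R h + x)"
      using False norm_triangle_ineq4[of "t n *\<^sub>R h + x" "t n *\<^sub>R h"] by simp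
    moreover have "R < norm x" using False norm_ge_zero[of h] by (simp del: norm_ge_zero)
    ultimately have "t n *\<^sub>R h + x \<notin> K" "x \<notin> K" using R by (meson not_le)+
    then show ?thesis using K(2) False by (simp add: s_def)
  qed
  have intt: "integrable lborel (\<lambda>x. f (t n *\<^sub>R h + x))"
    "(LINT x|lborel. f (t n *\<^sub>R h + x)) = (LINT x|lborel. f x)" for n
    using lborel_distr_plus[of "t n *\<^sub>R h"] intf
      integrable_distr_eq[of "(+) (t n *\<^sub>R h)" lborel borel f] integral_distr[of "(+) (t n *\<^sub>R h)" lborel borel f]
      borel_measurable_continuous_onI[OF contf] by simp_all
  have s0: "(LINT x|lborel. s n x) = 0" for n
    unfolding s_def using intt[of n] intf by simp
  have "(\<lambda>n. LINT x|lborel. s n x) \<longlonglongrightarrow> (LINT x|lborel. ?D x)"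
  proof (rule integral_dominated_convergence)
    show "integrable lborel (\<lambda>x::'a. C * indicator (cball 0 (R + norm h)) x)"
      by (intro integrable_mult_right integrable_real_indicator)
        (use emeasure_bounded_finite[of "cball 0 (R + norm h) :: 'a set"] in \<open>auto simp: less_top\<close>)
    show "?D \<in> borel_measurable lborel" by (rule borel_measurable_integrable[OF intD])
    show "s n \<in> borel_measurable lborel" for n
      unfolding s_def
      by (intro borel_measurable_divide borel_measurable_diff borel_measurable_const
          borel_measurable_integrable intt intf)
    show "AE x in lborel. (\<lambda>n. s n x) \<longlonglongrightarrow> ?D x" by (rule AE_I2) (rule lim)
    show "AE x in lborel. norm (s n x) \<le> C * indicator (cball 0 (R + norm h)) x" for n
      by (rule AE_I2) (rule bound)
  qed
  then show "(LINT x|lborel. ?D x) = 0" unfolding s0 by (simp add: LIMSEQ_const_iff)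
qed

section \<open>Charts\<close>

lemma smooth_on_has_derivative_within:
  assumes "smooth_on A f" "p \<in> A"
  obtains f' where "(f has_derivative f') (at p within A)"
proof -
  obtain W g where W: "open W" "p \<in> W" "\<And>k. Ck_on k W g" "\<And>x. x \<in> W \<inter> A \<Longrightarrow> g x = f x"
    using smooth_onE[OF assms] by metis
  obtain r where r: "r > 0" "ball p r \<subseteq> W" using W openE by blast
  have "(g has_derivative frechet_derivative g (at p)) (at p within A)"
    by (rule has_derivative_at_withinI[OF Ck_on_has_derivative[OF W(3)[of "Suc 0"] W(2)]])
  then have "(f has_derivative frechet_derivative g (at p)) (at p within A)"
  proof (rule has_derivative_transform_within[OF _ r(1) assms(2)])
    fix z assume "z \<in> A" "dist z p < r"
    then show "g z = f z" using W(4)[of z] r by (auto simp: dist_commute)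
  qed
  then show thesis by (rule that)
qed

text \<open>Derivatives within a relatively open subset of the half-plane are unique even at its edge,
  since every coordinate direction can be followed in its positive sense.\<close>

lemma half_plane_derivative_unique:
  fixes f :: "real^2 \<Rightarrow> 'b::real_normed_vector"
  assumes "openin (top_of_set half_plane) U" "q \<in> U"
    and "(f has_derivative f') (at q within U)" "(f has_derivative f'') (at q within U)"
  shows "f' = f''"
proof (rule frechet_derivative_unique_within[OF assms(3,4)])
  fix i :: "real^2" and r :: real assume i: "i \<in> Basis" "r > 0"
  obtain d where d: "d > 0" "\<And>x. x \<in> half_plane \<Longrightarrow> dist x q < d \<Longrightarrow> x \<in> U"
    using assms(1,2) unfolding openin_euclidean_subtopology_iff by blast
  have q: "0 \<le> q $ 1"
    using assms(1,2) openin_imp_subset by (fastforce simp: half_plane_def)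
  have "0 \<le> i $ 1" using i by (auto simp: Basis_vec_def axis_def)
  then have "q + (min r d / 2) *\<^sub>R i \<in> half_plane"
    using q i(2) d(1) by (simp add: half_plane_def)
  moreover have "dist (q + (min r d / 2) *\<^sub>R i) q < d"
    using i d(1) by (simp add: dist_norm)
  ultimately have "q + (min r d / 2) *\<^sub>R i \<in> U" by (rule d(2))
  then show "\<exists>s. 0 < \<bar>s\<bar> \<and> \<bar>s\<bar> < r \<and> q + s *\<^sub>R i \<in> U"
    using i(2) d(1) by (intro exI[of _ "min r d / 2"]) auto
qed

lemma local_param_has_derivative:
  assumes "local_param S U x" "q \<in> U"
  shows "(x has_derivative frechet_derivative x (at q within U)) (at q within U)"
proof -
  have "smooth_on U x" using assms(1) by (simp add: local_param_def)
  then obtain x' where "(x has_derivative x') (at q within U)"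
    using smooth_on_has_derivative_within assms(2) by metis
  then have "x differentiable (at q within U)" by (auto simp: differentiable_def)
  then show ?thesis by (simp add: frechet_derivative_works)
qed

text \<open>The chain rule applied to the smooth inverse of the chart gives a left inverse of its
  derivative.\<close>

lemma local_param_derivative_inj:
  assumes "local_param S U x" "q \<in> U" "frechet_derivative x (at q within U) k = 0"
  shows "k = 0"
proof -
  let ?x' = "frechet_derivative x (at q within U)"
  have U: "openin (top_of_set half_plane) U" using assms(1) by (simp add: local_param_def)
  obtain y where y: "smooth_on (x ` U) y" "\<And>q. q \<in> U \<Longrightarrow> y (x q) = q"
    using assms(1) unfolding local_param_def by auto
  obtain y' where y': "(y has_derivative y') (at (x q) within x ` U)"
    using smooth_on_has_derivative_within[OF y(1)] assms(2) by blast
  have "((\<lambda>q. y (x q)) has_derivative (\<lambda>k. y' (?x' k))) (at q within U)"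
    by (rule has_derivative_in_compose[OF local_param_has_derivative[OF assms(1,2)] y'])
  then have "((\<lambda>q. q) has_derivative (\<lambda>k. y' (?x' k))) (at q within U)"
    by (rule has_derivative_transform_within[OF _ zero_less_one assms(2)]) (simp add: y(2))
  then have "(\<lambda>k. y' (?x' k)) = (\<lambda>k. k)"
    by (rule half_plane_derivative_unique[OF U assms(2)]) (rule has_derivative_ident)
  then have "k = y' (?x' k)" by (simp add: fun_eq_iff)
  also have "\<dots> = 0" using assms(3) has_derivative_linear[OF y'] linear_0 by auto
  finally show ?thesis .
qed

section \<open>Graphs in an orthonormal frame\<close>

locale orthonormal_frame =
  fixes t1 t2 e :: "real^3"
  assumes unit: "t1 \<bullet> t1 = 1" "t2 \<bullet> t2 = 1" "e \<bullet> e = 1"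
    and orth: "t1 \<bullet> t2 = 0" "t1 \<bullet> e = 0" "t2 \<bullet> e = 0"
    and cross: "cross3 t1 t2 = e"
begin

lemma orth': "t2 \<bullet> t1 = 0" "e \<bullet> t1 = 0" "e \<bullet> t2 = 0"
  using orth by (simp_all add: inner_commute)

lemmas frame_simps = unit orth orth'

lemma frame_expand: "z = (z \<bullet> t1) *\<^sub>R t1 + (z \<bullet> t2) *\<^sub>R t2 + (z \<bullet> e) *\<^sub>R e"
proof -
  define w where "w = z - ((z \<bullet> t1) *\<^sub>R t1 + (z \<bullet> t2) *\<^sub>R t2 + (z \<bullet> e) *\<^sub>R e)"
  have w: "w \<bullet> t1 = 0" "w \<bullet> t2 = 0" "w \<bullet> e = 0"
    by (simp_all add: w_def inner_simps frame_simps)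
  have "cross3 w e = 0" using Lagrange[of w t1 t2] w by (simp add: cross)
  then have "(norm w * norm e)\<^sup>2 = 0" using norm_cross_dot[of w e] w by simp
  then have "w = 0" using unit(3) by auto
  then show ?thesis by (simp add: w_def)
qed

lemma frame_inner: "z \<bullet> w = (z \<bullet> t1) * (w \<bullet> t1) + (z \<bullet> t2) * (w \<bullet> t2) + (z \<bullet> e) * (w \<bullet> e)"
  by (subst frame_expand[of z]) (simp add: inner_simps inner_commute)

lemma frame_eqI:
  assumes "z \<bullet> t1 = w \<bullet> t1" "z \<bullet> t2 = w \<bullet> t2" "z \<bullet> e = w \<bullet> e"
  shows "z = w"
  using frame_expand[of z] frame_expand[of w] assms by simp

definition proj :: "real^3 \<Rightarrow> real^2" where
  "proj z = vector [z \<bullet> t1, z \<bullet> t2]"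

text \<open>The function \<open>h\<close> is the height over the linear plane spanned by \<open>t1\<close> and \<open>t2\<close>, so a graph
  over the affine plane \<open>e \<bullet> q = c\<close> has the constant \<open>c\<close> absorbed into \<open>h\<close>. Applied to the
  derivative of \<open>h\<close>, the same function is the derivative of the graph parametrization.\<close>

definition lift :: "(real^2 \<Rightarrow> real) \<Rightarrow> real^2 \<Rightarrow> real^3" where
  "lift h y = (y $ 1) *\<^sub>R t1 + (y $ 2) *\<^sub>R t2 + h y *\<^sub>R e"

lemma proj_component [simp]: "proj z $ 1 = z \<bullet> t1" "proj z $ 2 = z \<bullet> t2"
  by (simp_all add: proj_def)

lemma lift_inner [simp]: "lift h y \<bullet> t1 = y $ 1" "lift h y \<bullet> t2 = y $ 2" "lift h y \<bullet> e = h y"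
  by (simp_all add: lift_def inner_simps frame_simps)

lemma proj_lift [simp]: "proj (lift h y) = y"
  by (simp add: vec_eq_iff forall_2)

lemma linear_proj: "linear proj"
  by (rule linearI) (simp_all add: vec_eq_iff forall_2 inner_simps)

lemma bounded_linear_proj: "bounded_linear proj"
  using linear_proj by (simp add: linear_conv_bounded_linear)

lemma proj_eq_lift: "z \<bullet> e = h (proj z) \<Longrightarrow> lift h (proj z) = z"
  by (rule frame_eqI) simp_all

lemma lift_has_derivative:
  assumes "(h has_derivative h') (at y within A)"
  shows "(lift h has_derivative lift h') (at y within A)"
  unfolding lift_def[abs_def]
  by (intro has_derivative_add has_derivative_scaleR_left assms
      bounded_linear_imp_has_derivative bounded_linear_vec_nth)

lemma smooth_on_lift:
  assumes "smooth_on A h"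
  shows "smooth_on A (lift h)"
proof -
  have "smooth_on A (\<lambda>y::real^2. (y $ i) *\<^sub>R t)" for i and t :: "real^3"
    by (rule smooth_on_if_Ck_on[OF open_UNIV])
      (auto intro!: Ck_on_bounded_linear bounded_linear_scaleR_const bounded_linear_vec_nth)
  moreover have "smooth_on A (\<lambda>y. h y *\<^sub>R e)"
    by (rule smooth_on_bilinear[OF assms _ bounded_bilinear_scaleR])
      (rule smooth_on_if_Ck_on[OF open_UNIV], auto intro: Ck_on_const)
  ultimately show ?thesis unfolding lift_def[abs_def] by (intro smooth_on_add)
qed

end

text \<open>With \<open>t2 = cross3 e t1\<close>, the identity \<open>a \<times> (b \<times> c) = (a \<bullet> c) b - (a \<bullet> b) c\<close> gives the
  orientation \<open>cross3 t1 t2 = e\<close>.\<close>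

lemma orthonormal_frame_exists:
  assumes "norm e = 1"
  shows "\<exists>t1 t2. orthonormal_frame t1 t2 e"
proof -
  obtain a :: "real^3" where "a \<noteq> 0" "orthogonal e a"
    by (rule orthogonal_to_vector_exists[of e]) auto
  define t1 where "t1 = a /\<^sub>R norm a"
  have t1: "t1 \<bullet> t1 = 1" "e \<bullet> t1 = 0"
    using \<open>a \<noteq> 0\<close> \<open>orthogonal e a\<close> by (simp_all add: t1_def orthogonal_def dot_square_norm power2_eq_square)
  have e: "e \<bullet> e = 1" using assms by (simp add: dot_square_norm)
  define t2 where "t2 = cross3 e t1"
  have "(norm t2)\<^sup>2 = 1"
    using norm_cross_dot[of e t1] t1 e assms by (simp add: t2_def dot_square_norm power_mult_distrib)
  moreover have "cross3 t1 t2 = e"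
    unfolding t2_def Lagrange using t1 by (simp add: inner_commute)
  ultimately have "orthonormal_frame t1 t2 e"
    using t1 e by unfold_locales (simp_all add: t2_def dot_cross_self dot_square_norm inner_commute)
  then show ?thesis by blast
qed

section \<open>Graph surfaces\<close>

locale graph_surface = orthonormal_frame +
  fixes S :: "(real^3) set" and N :: "real^3 \<Rightarrow> real^3" and \<Omega> :: "(real^2) set" and h :: "real^2 \<Rightarrow> real"
  assumes surface: "surface S" and gauss: "gauss_map S N"
    and smooth_h: "smooth_on \<Omega> h" and S_eq: "S = lift h ` \<Omega>"
begin

lemma lift_in_S: "y \<in> \<Omega> \<Longrightarrow> lift h y \<in> S"
  by (simp add: S_eq)

lemma proj_in_\<Omega>: "p \<in> S \<Longrightarrow> proj p \<in> \<Omega>"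
  by (auto simp: S_eq)

lemma lift_proj: "p \<in> S \<Longrightarrow> lift h (proj p) = p"
  by (auto simp: S_eq)

lemma proj_S: "proj ` S = \<Omega>"
  by (force simp: S_eq image_image)

lemma continuous_on_lift: "continuous_on \<Omega> (lift h)"
  by (intro smooth_on_imp_continuous_on smooth_on_lift smooth_h)

lemma norm_N: "p \<in> S \<Longrightarrow> N p \<bullet> N p = 1"
  using gauss by (simp add: gauss_map_def dot_square_norm)

lemma N_tangent: "p \<in> S \<Longrightarrow> w \<in> tangent_space S p \<Longrightarrow> N p \<bullet> w = 0"
  using gauss by (simp add: gauss_map_def)

text \<open>On the domain of a chart \<open>x\<close> one has \<open>x = lift h \<circ> proj \<circ> x\<close>. Differentiating within that
  domain also covers boundary points, where \<open>h\<close> has a derivative only within \<open>\<Omega>\<close>.\<close>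

lemma chart_derivative:
  assumes U: "local_param S U x" "q \<in> U"
    and h': "(h has_derivative h') (at (proj (x q)) within \<Omega>)"
  shows "frechet_derivative x (at q within U) k =
    lift h' (proj (frechet_derivative x (at q within U) k))"
proof -
  let ?x' = "frechet_derivative x (at q within U)"
  have xS: "x r \<in> S" if "r \<in> U" for r
    using U(1) that openin_imp_subset unfolding local_param_def by blast
  have x': "(x has_derivative ?x') (at q within U)" by (rule local_param_has_derivative[OF U])
  have "((\<lambda>r. proj (x r)) has_derivative (\<lambda>k. proj (?x' k))) (at q within U)"
    by (rule bounded_linear.has_derivative[OF bounded_linear_proj x'])
  moreover have "(lift h has_derivative lift h') (at (proj (x q)) within ((\<lambda>r. proj (x r)) ` U))"
    by (rule has_derivative_subset[OF lift_has_derivative[OF h']]) (auto simp: proj_in_\<Omega> xS)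
  ultimately have "((\<lambda>r. lift h (proj (x r))) has_derivative (\<lambda>k. lift h' (proj (?x' k)))) (at q within U)"
    by (rule has_derivative_in_compose)
  then have "(x has_derivative (\<lambda>k. lift h' (proj (?x' k)))) (at q within U)"
    by (rule has_derivative_transform_within[OF _ zero_less_one U(2)]) (simp add: lift_proj xS)
  then have "?x' = (\<lambda>k. lift h' (proj (?x' k)))"
    using half_plane_derivative_unique[OF _ U(2) x'] U(1) unfolding local_param_def by blast
  then show ?thesis by metis
qed

text \<open>The identity \<open>chart_derivative\<close> recovers the derivative of a chart from its projection to the plane, so
  the projected derivative is injective, hence bijective. Charts of a graph are therefore nowhere
  vertical, including at the boundary.\<close>

lemma proj_chart_derivative_surj:
  assumes U: "local_param S U x" "q \<in> U"
  obtains k where "proj (frechet_derivative x (at q within U) k) = y"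
proof -
  let ?x' = "frechet_derivative x (at q within U)"
  have "x q \<in> S" using U openin_imp_subset unfolding local_param_def by blast
  then obtain h' where h': "(h has_derivative h') (at (proj (x q)) within \<Omega>)"
    using smooth_on_has_derivative_within[OF smooth_h proj_in_\<Omega>] by metis
  have linx: "linear ?x'" by (rule has_derivative_linear[OF local_param_has_derivative[OF U]])
  have lin: "linear (\<lambda>k. proj (?x' k))"
    using linear_compose[OF linx linear_proj] by (simp add: o_def)
  have "k = 0" if "proj (?x' k) = 0" for k
  proof -
    have "lift h' 0 = 0" using has_derivative_linear[OF h'] by (simp add: lift_def linear_0)
    then have "?x' k = 0" using chart_derivative[OF U h', of k] that by simp
    then show ?thesis by (rule local_param_derivative_inj[OF U])
  qed
  then have "inj (\<lambda>k. proj (?x' k))" using linear_injective_0[OF lin] by blast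
  then have "surj (\<lambda>k. proj (?x' k))" by (rule linear_inj_imp_surj[OF lin])
  then show thesis using that by (metis surjD)
qed

lemma chart_at:
  assumes "p \<in> S"
  obtains U x q where "local_param S U x" "q \<in> U" "x q = p"
proof -
  obtain U x where "local_param S U x" "p \<in> x ` U"
    using surface assms unfolding surface_def by blast
  then show thesis using that by blast
qed

lemma chart_derivative_tangent:
  assumes "local_param S U x" "q \<in> U"
  shows "frechet_derivative x (at q within U) k \<in> tangent_space S (x q)"
  using assms unfolding tangent_space_def by blast

text \<open>If \<open>N p\<close> were horizontal, some tangent vector would have the same horizontal part as \<open>N p\<close>
  and its inner product with \<open>N p\<close> would be \<open>N p \<bullet> N p = 1\<close>.\<close>

lemma N_e_nonzero:
  assumes p: "p \<in> S"
  shows "N p \<bullet> e \<noteq> 0"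
proof
  assume 0: "N p \<bullet> e = 0"
  obtain U x q where U: "local_param S U x" "q \<in> U" and xq: "x q = p"
    using chart_at[OF p] by metis
  obtain k where k: "proj (frechet_derivative x (at q within U) k) = proj (N p)"
    using proj_chart_derivative_surj[OF U] by metis
  let ?w = "frechet_derivative x (at q within U) k"
  have "?w \<in> tangent_space S p" using chart_derivative_tangent[OF U] xq by metis
  then have "N p \<bullet> ?w = 0" by (rule N_tangent[OF p])
  moreover have "?w \<bullet> t1 = N p \<bullet> t1" "?w \<bullet> t2 = N p \<bullet> t2"
    using k by (metis proj_component)+
  ultimately have "N p \<bullet> N p = 0"
    using frame_inner[of "N p" ?w] frame_inner[of "N p" "N p"] 0 by simp
  then show False using norm_N[OF p] by simp
qed

lemma eq_if_orthogonal_to_N: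
  assumes "p \<in> S" "N p \<bullet> z = 0" "N p \<bullet> w = 0" "proj z = proj w"
  shows "z = w"
proof -
  have pr: "z \<bullet> t1 = w \<bullet> t1" "z \<bullet> t2 = w \<bullet> t2" using assms(4) by (metis proj_component)+
  have "(N p \<bullet> e) * (z \<bullet> e) = (N p \<bullet> e) * (w \<bullet> e)"
    using frame_inner[of "N p" z] frame_inner[of "N p" w] assms(2,3) unfolding pr by linarith
  then have "z \<bullet> e = w \<bullet> e" using N_e_nonzero[OF assms(1)] by simp
  then show ?thesis using pr by (intro frame_eqI)
qed

lemma tangent_space_eq:
  assumes p: "p \<in> S"
  shows "tangent_space S p = {w. N p \<bullet> w = 0}"
proof (intro equalityI subsetI CollectI)
  fix w assume "w \<in> {w. N p \<bullet> w = 0}"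
  then have w: "N p \<bullet> w = 0" by simp
  obtain U x q where U: "local_param S U x" "q \<in> U" and xq: "x q = p"
    using chart_at[OF p] by metis
  obtain k where k: "proj (frechet_derivative x (at q within U) k) = proj w"
    using proj_chart_derivative_surj[OF U] by metis
  have t: "frechet_derivative x (at q within U) k \<in> tangent_space S p"
    using chart_derivative_tangent[OF U] xq by metis
  have "frechet_derivative x (at q within U) k = w"
    by (rule eq_if_orthogonal_to_N[OF p N_tangent[OF p t] w k])
  then show "w \<in> tangent_space S p" using t by simp
qed (use N_tangent[OF p] in auto)

lemma lift_derivative_tangent:
  assumes y: "y \<in> \<Omega>" and h': "(h has_derivative h') (at y within \<Omega>)"
  shows "N (lift h y) \<bullet> lift h' k = 0"
proof -
  note p = lift_in_S[OF y]
  obtain U x q where U: "local_param S U x" "q \<in> U" and xq: "x q = lift h y"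
    using chart_at[OF p] by metis
  obtain k' where k': "proj (frechet_derivative x (at q within U) k') = k"
    using proj_chart_derivative_surj[OF U] by metis
  have "frechet_derivative x (at q within U) k' = lift h' k"
    using chart_derivative[OF U, of h' k'] h' k' xq by simp
  moreover have "frechet_derivative x (at q within U) k' \<in> tangent_space S (lift h y)"
    using chart_derivative_tangent[OF U] xq by metis
  ultimately show ?thesis using N_tangent[OF p] by metis
qed

text \<open>Along \<open>S\<close> the identity map has the orthogonal projection to the tangent plane as one of its
  derivatives at \<open>p\<close>, because \<open>x \<mapsto> N p \<bullet> x\<close> has derivative zero within \<open>S\<close>. Composing any
  derivative of \<open>f\<close> within \<open>S\<close> with it yields one that vanishes on the normal line.\<close>

lemma surface_differential_eq:
  fixes f :: "real^3 \<Rightarrow> 'b::real_normed_vector"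
  assumes y: "y \<in> interior \<Omega>" and f: "((\<lambda>y. f (lift h y)) has_derivative f') (at y)"
  shows "surface_differential S f (lift h y) =
    (\<lambda>z. f' (proj (z - (N (lift h y) \<bullet> z) *\<^sub>R N (lift h y))))"
proof -
  define p where "p = lift h y"
  define n where "n = N p"
  define T where "T z = z - (n \<bullet> z) *\<^sub>R n" for z
  have y\<Omega>: "y \<in> \<Omega>" using y interior_subset by blast
  have pS: "p \<in> S" and yp: "y = proj p" using lift_in_S[OF y\<Omega>] by (simp_all add: p_def)
  have n1: "n \<bullet> n = 1" using norm_N[OF pS] by (simp add: n_def)
  obtain h' where h': "(h has_derivative h') (at y within \<Omega>)"
    using smooth_on_has_derivative_within[OF smooth_h y\<Omega>] by metis
  have nh': "n \<bullet> lift h' k = 0" for k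
    using lift_derivative_tangent[OF y\<Omega> h'] by (simp add: n_def p_def)
  have Th: "T z = lift h' (proj (T z))" for z
    by (rule eq_if_orthogonal_to_N[OF pS])
      (use nh' in \<open>simp_all add: n_def[symmetric] T_def inner_simps n1\<close>)
  have dproj: "(proj has_derivative proj) (at p within S)"
    by (rule bounded_linear_imp_has_derivative[OF bounded_linear_proj])
  have dlift: "(lift h has_derivative lift h') (at (proj p) within proj ` S)"
    using lift_has_derivative[OF h'] by (simp add: yp proj_S)
  have "((\<lambda>x. lift h (proj x)) has_derivative (\<lambda>z. lift h' (proj z))) (at p within S)"
    by (rule has_derivative_in_compose[OF dproj dlift])
  then have "((\<lambda>x. x) has_derivative (\<lambda>z. lift h' (proj z))) (at p within S)"
    by (rule has_derivative_transform_within[OF _ zero_less_one pS]) (simp add: lift_proj)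
  then have "((\<lambda>x. n \<bullet> x) has_derivative (\<lambda>z. n \<bullet> lift h' (proj z))) (at p within S)"
    by (rule has_derivative_inner_right)
  then have "((\<lambda>x. n \<bullet> x) has_derivative (\<lambda>z. 0)) (at p within S)" by (simp add: nh')
  then have "((\<lambda>x. (n \<bullet> x) *\<^sub>R n) has_derivative (\<lambda>z. 0 *\<^sub>R n)) (at p within S)"
    by (rule has_derivative_scaleR_left)
  then have flat: "((\<lambda>x. (n \<bullet> x) *\<^sub>R n) has_derivative (\<lambda>z. 0)) (at p within S)" by simp
  have "((\<lambda>x. (x - (n \<bullet> x) *\<^sub>R n) + (n \<bullet> x) *\<^sub>R n) has_derivative (\<lambda>z. T z + 0)) (at p within S)"
    unfolding T_def
    by (intro has_derivative_add flat bounded_linear_imp_has_derivative bounded_linear_sub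
        bounded_linear_ident bounded_linear_scaleR_const bounded_linear_inner_right)
  then have idT: "((\<lambda>x. x) has_derivative T) (at p within S)" by simp
  have "((\<lambda>x. f (lift h (proj x))) has_derivative (\<lambda>z. f' (proj z))) (at p within S)"
    by (rule has_derivative_compose[OF dproj]) (use f in \<open>simp add: yp\<close>)
  then have "(f has_derivative (\<lambda>z. f' (proj z))) (at p within S)"
    by (rule has_derivative_transform_within[OF _ zero_less_one pS]) (simp add: lift_proj)
  then have "(f has_derivative (\<lambda>z. f' (proj z))) (at p within (\<lambda>x. x) ` S)" by simp
  from has_derivative_in_compose[OF idT this]
  have fT: "(f has_derivative (\<lambda>z. f' (proj (T z)))) (at p within S)" .
  have lin: "linear f'" by (rule has_derivative_linear[OF f])
  have normal: "w = (n \<bullet> w) *\<^sub>R n" if "\<forall>v\<in>tangent_space S p. w \<bullet> v = 0" for w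
  proof -
    have T: "n \<bullet> T w = 0" by (simp add: T_def inner_diff_right n1)
    then have "w \<bullet> T w = 0" using that tangent_space_eq[OF pS] by (simp add: n_def)
    then have "T w \<bullet> T w = 0" using T by (simp add: T_def inner_diff_left)
    then show ?thesis by (simp add: T_def)
  qed
  have Tn: "T (c *\<^sub>R n) = 0" for c by (simp add: T_def n1)
  have "(THE D. (f has_derivative D) (at p within S) \<and>
      (\<forall>w. (\<forall>v\<in>tangent_space S p. w \<bullet> v = 0) \<longrightarrow> D w = 0)) = (\<lambda>z. f' (proj (T z)))"
  proof (rule the_equality, intro conjI allI impI fT)
    fix w assume "\<forall>v\<in>tangent_space S p. w \<bullet> v = 0"
    then have "T w = 0" using normal Tn by metis
    then show "f' (proj (T w)) = 0" using linear_0[OF lin] linear_0[OF linear_proj] by simp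
  next
    fix D assume D: "(f has_derivative D) (at p within S) \<and>
      (\<forall>w. (\<forall>v\<in>tangent_space S p. w \<bullet> v = 0) \<longrightarrow> D w = 0)"
    have "((\<lambda>y. f (lift h y)) has_derivative (\<lambda>k. D (lift h' k))) (at y within \<Omega>)"
      by (rule has_derivative_in_compose[OF lift_has_derivative[OF h']])
        (use D in \<open>simp add: p_def S_eq[symmetric]\<close>)
    then have "((\<lambda>y. f (lift h y)) has_derivative (\<lambda>k. D (lift h' k))) (at y)"
      using at_within_interior[OF y] by simp
    then have f'D: "f' = (\<lambda>k. D (lift h' k))" by (rule has_derivative_unique[OF f])
    have linD: "linear D" using D has_derivative_linear by blast
    have Dn: "D n = 0" using D tangent_space_eq[OF pS] by (simp add: n_def)
    show "D = (\<lambda>z. f' (proj (T z)))"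
    proof
      fix z
      have "D z = D (T z) + (n \<bullet> z) *\<^sub>R D n"
        by (simp add: linear_scale[OF linD, symmetric] linear_add[OF linD, symmetric] T_def)
      then show "D z = f' (proj (T z))" using Dn Th[of z] f'D by simp
    qed
  qed
  then show ?thesis unfolding surface_differential_def by (simp add: p_def n_def T_def)
qed

lemma surface_gradient_eq:
  assumes y: "y \<in> interior \<Omega>" and f: "((\<lambda>y. f (lift h y)) has_derivative f') (at y)"
  shows "N (lift h y) \<bullet> surface_gradient S f (lift h y) = 0"
    "N (lift h y) \<bullet> w = 0 \<Longrightarrow> surface_gradient S f (lift h y) \<bullet> w = f' (proj w)"
proof -
  define p where "p = lift h y"
  define D where "D = surface_differential S f p"
  have D: "D z = f' (proj (z - (N p \<bullet> z) *\<^sub>R N p))" for z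
    unfolding D_def p_def by (simp add: surface_differential_eq[OF y f])
  have pS: "p \<in> S" using y interior_subset lift_in_S by (auto simp: p_def)
  note lin = has_derivative_linear[OF f] linear_proj
  have "linear (\<lambda>z. z - (N p \<bullet> z) *\<^sub>R N p)"
    by (rule linearI) (simp_all add: inner_add_right algebra_simps)
  then have "linear (f' \<circ> (proj \<circ> (\<lambda>z. z - (N p \<bullet> z) *\<^sub>R N p)))"
    by (intro linear_compose lin)
  moreover have "D = f' \<circ> (proj \<circ> (\<lambda>z. z - (N p \<bullet> z) *\<^sub>R N p))"
    by (simp add: D fun_eq_iff)
  ultimately have linD: "linear D" by simp
  define g where "g = (\<Sum>b\<in>Basis. D b *\<^sub>R b)"
  have g: "g \<bullet> z = D z" for z
  proof -
    have "D z = D (\<Sum>b\<in>Basis. (z \<bullet> b) *\<^sub>R b)" by (simp add: euclidean_representation)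
    also have "\<dots> = (\<Sum>b\<in>Basis. (z \<bullet> b) * D b)"
      by (simp add: linear_sum[OF linD] linear_scale[OF linD])
    finally show ?thesis by (simp add: g_def inner_sum_right inner_commute[of _ z] mult.commute)
  qed
  have Dn: "D (N p) = 0"
    using linear_0[OF lin(1)] linear_0[OF lin(2)] by (simp add: D norm_N[OF pS])
  have gn: "N p \<bullet> g = 0" using g[of "N p"] Dn by (simp add: inner_commute)
  have "surface_gradient S f p = g"
    unfolding surface_gradient_def D_def[symmetric] tangent_space_eq[OF pS]
  proof (rule the_equality)
    fix g' assume g': "g' \<in> {w. N p \<bullet> w = 0} \<and> (\<forall>w\<in>{w. N p \<bullet> w = 0}. g' \<bullet> w = D w)"
    then have "(g' - g) \<bullet> (g' - g) = 0"
      using gn g by (simp add: inner_diff_left inner_diff_right)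
    then show "g' = g" by simp
  qed (use g gn in auto)
  then show "N (lift h y) \<bullet> surface_gradient S f (lift h y) = 0"
    "N (lift h y) \<bullet> w = 0 \<Longrightarrow> surface_gradient S f (lift h y) \<bullet> w = f' (proj w)"
    using g[of w] gn D[of w] by (simp_all add: p_def)
qed

end

section \<open>Curvature of a graph in coordinates\<close>

abbreviation partial :: "2 \<Rightarrow> (real^2 \<Rightarrow> 'b::real_normed_vector) \<Rightarrow> real^2 \<Rightarrow> 'b" where
  "partial i f y \<equiv> frechet_derivative f (at y) (axis i 1)"

lemma linear_eq_partials:
  fixes f :: "real^2 \<Rightarrow> 'b::real_vector"
  assumes "linear f"
  shows "f w = (w $ 1) *\<^sub>R f (axis 1 1) + (w $ 2) *\<^sub>R f (axis 2 1)"
proof -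
  have "w = (w $ 1) *\<^sub>R axis 1 1 + (w $ 2) *\<^sub>R axis 2 1"
    by (simp add: vec_eq_iff forall_2 axis_def)
  then show ?thesis
    by (metis linear_add[OF assms] linear_scale[OF assms])
qed

context orthonormal_frame
begin

text \<open>The vectors \<open>G1\<close> and \<open>G2\<close> are the coordinate tangent vectors of a graph with slopes \<open>h1\<close>
  and \<open>h2\<close>. Tangent vectors have the same coefficients in \<open>G1, G2\<close> as their horizontal parts in
  \<open>t1, t2\<close>, and all formulas below are instances of this.\<close>

lemma tangent_frame:
  fixes n :: "real^3" and h1 h2 :: real
  defines "G1 \<equiv> t1 + h1 *\<^sub>R e" and "G2 \<equiv> t2 + h2 *\<^sub>R e"
  assumes n3: "n \<bullet> e \<noteq> 0" and n1: "n \<bullet> n = 1" and nG: "n \<bullet> G1 = 0" "n \<bullet> G2 = 0"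
  shows tangent_frame_expand: "n \<bullet> z = 0 \<Longrightarrow> z = (z \<bullet> t1) *\<^sub>R G1 + (z \<bullet> t2) *\<^sub>R G2"
    and tangent_part_t1: "t1 - (n \<bullet> t1) *\<^sub>R n = (1 - (n \<bullet> t1)\<^sup>2) *\<^sub>R G1 - ((n \<bullet> t1) * (n \<bullet> t2)) *\<^sub>R G2"
    and tangent_part_t2: "t2 - (n \<bullet> t2) *\<^sub>R n = (1 - (n \<bullet> t2)\<^sup>2) *\<^sub>R G2 - ((n \<bullet> t1) * (n \<bullet> t2)) *\<^sub>R G1"
    and tangent_part_e: "(n \<bullet> t1) *\<^sub>R G1 + (n \<bullet> t2) *\<^sub>R G2 = n - (1 / (n \<bullet> e)) *\<^sub>R e"
proof -
  have expand: "z = (z \<bullet> t1) *\<^sub>R G1 + (z \<bullet> t2) *\<^sub>R G2" if "n \<bullet> z = 0" for z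
  proof (rule frame_eqI)
    let ?w = "(z \<bullet> t1) *\<^sub>R G1 + (z \<bullet> t2) *\<^sub>R G2"
    show 1: "z \<bullet> t1 = ?w \<bullet> t1" "z \<bullet> t2 = ?w \<bullet> t2"
      by (simp_all add: G1_def G2_def inner_simps frame_simps)
    have "n \<bullet> ?w = 0" using nG by (simp add: inner_add_right)
    then have "(n \<bullet> e) * (z \<bullet> e) = (n \<bullet> e) * (?w \<bullet> e)"
      using frame_inner[of n z] frame_inner[of n ?w] that unfolding 1[symmetric] by linarith
    then show "z \<bullet> e = ?w \<bullet> e" using n3 by simp
  qed
  then show "n \<bullet> z = 0 \<Longrightarrow> z = (z \<bullet> t1) *\<^sub>R G1 + (z \<bullet> t2) *\<^sub>R G2" .
  have s: "n \<bullet> (t1 - (n \<bullet> t1) *\<^sub>R n) = 0" "n \<bullet> (t2 - (n \<bullet> t2) *\<^sub>R n) = 0"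
    "n \<bullet> (n - (1 / (n \<bullet> e)) *\<^sub>R e) = 0"
    using n3 n1 by (simp_all add: inner_diff_right)
  show "t1 - (n \<bullet> t1) *\<^sub>R n = (1 - (n \<bullet> t1)\<^sup>2) *\<^sub>R G1 - ((n \<bullet> t1) * (n \<bullet> t2)) *\<^sub>R G2"
    "t2 - (n \<bullet> t2) *\<^sub>R n = (1 - (n \<bullet> t2)\<^sup>2) *\<^sub>R G2 - ((n \<bullet> t1) * (n \<bullet> t2)) *\<^sub>R G1"
    "(n \<bullet> t1) *\<^sub>R G1 + (n \<bullet> t2) *\<^sub>R G2 = n - (1 / (n \<bullet> e)) *\<^sub>R e"
    using expand[OF s(1)] expand[OF s(2)] expand[OF s(3)]
    by (simp_all add: inner_diff_left frame_simps power2_eq_square algebra_simps)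
qed

text \<open>Here \<open>a1\<close> and \<open>a2\<close> are the derivatives of the Gauss map along \<open>G1\<close> and \<open>G2\<close>, and the
  hypothesis \<open>a1 \<bullet> G2 = a2 \<bullet> G1\<close> is the self-adjointness of the shape operator. The first
  identity computes \<open>|A|\<^sup>2\<close>, the sum of squares in orthonormal directions, as the trace of the
  squared operator in the basis \<open>G1, G2\<close>. The vector \<open>\<zeta>\<close> is \<open>\<nabla>\<psi> / \<psi>\<close> for
  \<open>\<psi> = n \<bullet> e\<close>, since the gradient of \<open>\<psi>\<close> is \<open>dN\<close> applied to the tangential part of \<open>e\<close>.\<close>

lemma shape_operator_identities:
  fixes n a1 a2 :: "real^3" and h1 h2 :: real
  defines "G1 \<equiv> t1 + h1 *\<^sub>R e" and "G2 \<equiv> t2 + h2 *\<^sub>R e"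
    and "q1 \<equiv> (n \<bullet> t1) * (a1 \<bullet> t1) + (n \<bullet> t2) * (a2 \<bullet> t1)"
    and "q2 \<equiv> (n \<bullet> t1) * (a1 \<bullet> t2) + (n \<bullet> t2) * (a2 \<bullet> t2)"
    and "\<zeta> \<equiv> - ((n \<bullet> t1) *\<^sub>R a1 + (n \<bullet> t2) *\<^sub>R a2)"
  assumes n3: "n \<bullet> e \<noteq> 0" and n1: "n \<bullet> n = 1" and nG: "n \<bullet> G1 = 0" "n \<bullet> G2 = 0"
    and na: "n \<bullet> a1 = 0" "n \<bullet> a2 = 0" and sym: "a1 \<bullet> G2 = a2 \<bullet> G1"
  shows "(1 - (n \<bullet> t1)\<^sup>2) * (a1 \<bullet> a1) - 2 * ((n \<bullet> t1) * (n \<bullet> t2)) * (a1 \<bullet> a2) + (1 - (n \<bullet> t2)\<^sup>2) * (a2 \<bullet> a2)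
      = (a1 \<bullet> t1)\<^sup>2 + 2 * ((a1 \<bullet> t2) * (a2 \<bullet> t1)) + (a2 \<bullet> t2)\<^sup>2" (is ?A)
    and "n \<bullet> g = 0 \<Longrightarrow> g \<bullet> \<zeta> = - (q1 * (g \<bullet> G1) + q2 * (g \<bullet> G2))" (is "_ \<Longrightarrow> ?B")
    and "\<zeta> \<bullet> \<zeta> = - (q1 * (a1 \<bullet> e) + q2 * (a2 \<bullet> e)) / (n \<bullet> e)" (is ?C)
proof -
  note tf = tangent_frame[OF n3 n1, of h1 h2, folded G1_def G2_def, OF nG]
  have ab: "z \<bullet> a1 = (a1 \<bullet> t1) * (z \<bullet> G1) + (a1 \<bullet> t2) * (z \<bullet> G2)"
    "z \<bullet> a2 = (a2 \<bullet> t1) * (z \<bullet> G1) + (a2 \<bullet> t2) * (z \<bullet> G2)" for z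
    using arg_cong[OF tf(1)[OF na(1)], of "\<lambda>x. z \<bullet> x"] arg_cong[OF tf(1)[OF na(2)], of "\<lambda>x. z \<bullet> x"]
    by (simp_all add: inner_add_right)
  have na': "a1 \<bullet> n = 0" "a2 \<bullet> n = 0" using na by (simp_all add: inner_commute)
  have T: "a \<bullet> t1 = (1 - (n \<bullet> t1)\<^sup>2) * (a \<bullet> G1) - ((n \<bullet> t1) * (n \<bullet> t2)) * (a \<bullet> G2)"
    "a \<bullet> t2 = (1 - (n \<bullet> t2)\<^sup>2) * (a \<bullet> G2) - ((n \<bullet> t1) * (n \<bullet> t2)) * (a \<bullet> G1)"
    "(n \<bullet> t1) * (a \<bullet> G1) + (n \<bullet> t2) * (a \<bullet> G2) = - (a \<bullet> e) / (n \<bullet> e)" if "a \<bullet> n = 0" for a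
    using arg_cong[OF tf(2), of "\<lambda>x. a \<bullet> x"] arg_cong[OF tf(3), of "\<lambda>x. a \<bullet> x"]
      arg_cong[OF tf(4), of "\<lambda>x. a \<bullet> x"] that
    by (simp_all add: inner_add_right inner_diff_right)
  define b11 b12 b22 where b: "b11 = a1 \<bullet> G1" "b12 = a1 \<bullet> G2" "b22 = a2 \<bullet> G2"
  have b21: "a2 \<bullet> G1 = b12" using sym b by simp
  have p: "a1 \<bullet> a1 = (a1 \<bullet> t1) * b11 + (a1 \<bullet> t2) * b12"
    "a1 \<bullet> a2 = (a2 \<bullet> t1) * b11 + (a2 \<bullet> t2) * b12"
    "a1 \<bullet> a2 = (a1 \<bullet> t1) * b12 + (a1 \<bullet> t2) * b22"
    "a2 \<bullet> a2 = (a2 \<bullet> t1) * b12 + (a2 \<bullet> t2) * b22"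
    using ab(1)[of a1] ab(2)[of a1] ab(1)[of a2] ab(2)[of a2]
    by (simp_all add: b21 b[symmetric] inner_commute[of a2 a1])
  define x y z w where xy: "x = a1 \<bullet> t1" "y = a1 \<bullet> t2" "z = a2 \<bullet> t1" "w = a2 \<bullet> t2"
  define m1 m2 where m: "m1 = n \<bullet> t1" "m2 = n \<bullet> t2"
  have T': "x = (1 - m1\<^sup>2) * b11 - (m1 * m2) * b12" "y = (1 - m2\<^sup>2) * b12 - (m1 * m2) * b11"
    "z = (1 - m1\<^sup>2) * b12 - (m1 * m2) * b22" "w = (1 - m2\<^sup>2) * b22 - (m1 * m2) * b12"
    using T(1,2)[OF na'(1)] T(1,2)[OF na'(2)] by (simp_all add: b21 b[symmetric] m xy)
  have "(1 - m1\<^sup>2) * (a1 \<bullet> a1) - 2 * (m1 * m2) * (a1 \<bullet> a2) + (1 - m2\<^sup>2) * (a2 \<bullet> a2)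
    = (1 - m1\<^sup>2) * (x * b11 + y * b12) - (m1 * m2) * (z * b11 + w * b12)
      - (m1 * m2) * (x * b12 + y * b22) + (1 - m2\<^sup>2) * (z * b12 + w * b22)"
    using p by (simp add: xy m algebra_simps)
  also have "\<dots> = x * ((1 - m1\<^sup>2) * b11 - (m1 * m2) * b12) + y * ((1 - m1\<^sup>2) * b12 - (m1 * m2) * b22)
     + z * ((1 - m2\<^sup>2) * b12 - (m1 * m2) * b11) + w * ((1 - m2\<^sup>2) * b22 - (m1 * m2) * b12)"
    by (simp add: algebra_simps)
  also have "\<dots> = x\<^sup>2 + 2 * (y * z) + w\<^sup>2"
    unfolding T'[symmetric] by (simp add: power2_eq_square)
  finally show ?A by (simp add: xy m)
  have "n \<bullet> \<zeta> = 0" by (simp add: \<zeta>_def inner_diff_right na)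
  moreover have "\<zeta> \<bullet> t1 = - q1" "\<zeta> \<bullet> t2 = - q2"
    by (simp_all add: \<zeta>_def q1_def q2_def inner_diff_left)
  ultimately have \<zeta>: "\<zeta> = - (q1 *\<^sub>R G1 + q2 *\<^sub>R G2)"
    using tf(1)[of \<zeta>] by simp
  show ?B by (simp add: \<zeta> inner_diff_right)
  have "\<zeta> \<bullet> G1 = (a1 \<bullet> e) / (n \<bullet> e)" "\<zeta> \<bullet> G2 = (a2 \<bullet> e) / (n \<bullet> e)"
    using T(3)[OF na'(1)] T(3)[OF na'(2)] sym by (simp_all add: \<zeta>_def inner_diff_left)
  then have "\<zeta> \<bullet> - (q1 *\<^sub>R G1 + q2 *\<^sub>R G2) = - (q1 * (a1 \<bullet> e) + q2 * (a2 \<bullet> e)) / (n \<bullet> e)"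
    by (simp add: inner_diff_right add_divide_distrib diff_divide_distrib)
  then show ?C using \<zeta> by metis
qed

text \<open>This is \<open>0 \<le> |g - u \<nabla>\<psi> / \<psi>|\<^sup>2\<close> written out in coordinates.\<close>

lemma stability_density_inequality:
  fixes n a1 a2 g :: "real^3" and h1 h2 u :: real
  defines "G1 \<equiv> t1 + h1 *\<^sub>R e" and "G2 \<equiv> t2 + h2 *\<^sub>R e"
    and "q1 \<equiv> (n \<bullet> t1) * (a1 \<bullet> t1) + (n \<bullet> t2) * (a2 \<bullet> t1)"
    and "q2 \<equiv> (n \<bullet> t1) * (a1 \<bullet> t2) + (n \<bullet> t2) * (a2 \<bullet> t2)"
  assumes n3: "n \<bullet> e \<noteq> 0" and n1: "n \<bullet> n = 1" and nG: "n \<bullet> G1 = 0" "n \<bullet> G2 = 0"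
    and na: "n \<bullet> a1 = 0" "n \<bullet> a2 = 0" and sym: "a1 \<bullet> G2 = a2 \<bullet> G1"
    and ng: "n \<bullet> g = 0"
  shows "- (2 * u * (q1 * (g \<bullet> G1) + q2 * (g \<bullet> G2)))
      + u\<^sup>2 * (q1 * (a1 \<bullet> e) + q2 * (a2 \<bullet> e)) / (n \<bullet> e) \<le> (norm g)\<^sup>2"
proof -
  define \<zeta> where "\<zeta> = - ((n \<bullet> t1) *\<^sub>R a1 + (n \<bullet> t2) *\<^sub>R a2)"
  note id = shape_operator_identities[OF n3 n1, of h1 h2 a1 a2, folded G1_def G2_def q1_def q2_def \<zeta>_def,
      OF nG na sym]
  have "0 \<le> (g - u *\<^sub>R \<zeta>) \<bullet> (g - u *\<^sub>R \<zeta>)" by (rule inner_ge_zero)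
  also have "\<dots> = g \<bullet> g - 2 * u * (g \<bullet> \<zeta>) + u\<^sup>2 * (\<zeta> \<bullet> \<zeta>)"
    by (simp add: inner_diff_left inner_diff_right inner_commute[of \<zeta> g] power2_eq_square algebra_simps)
  finally have *: "0 \<le> g \<bullet> g - 2 * u * (g \<bullet> \<zeta>) + u\<^sup>2 * (\<zeta> \<bullet> \<zeta>)" .
  define A B where AB: "A = q1 * (g \<bullet> G1) + q2 * (g \<bullet> G2)" "B = q1 * (a1 \<bullet> e) + q2 * (a2 \<bullet> e)"
  show ?thesis
    using * unfolding id(2)[OF ng] id(3) power2_norm_eq_inner AB[symmetric] by simp
qed

end

context graph_surface
begin

lemma
  assumes y: "y \<in> interior \<Omega>" and N': "((\<lambda>y. N (lift h y)) has_derivative n') (at y)"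
  defines "n \<equiv> N (lift h y)" and "a1 \<equiv> n' (axis 1 1)" and "a2 \<equiv> n' (axis 2 1)"
  assumes na: "n \<bullet> a1 = 0" "n \<bullet> a2 = 0"
  shows mean_curvature_eq: "mean_curvature S N (lift h y) = - (a1 \<bullet> t1 + a2 \<bullet> t2)"
    and sff_norm_sq_eq: "sff_norm_sq S N (lift h y) =
      (1 - (n \<bullet> t1)\<^sup>2) * (a1 \<bullet> a1) - 2 * ((n \<bullet> t1) * (n \<bullet> t2)) * (a1 \<bullet> a2) + (1 - (n \<bullet> t2)\<^sup>2) * (a2 \<bullet> a2)"
proof -
  define \<tau>1 \<tau>2 where \<tau>: "\<tau>1 = t1 - (n \<bullet> t1) *\<^sub>R n" "\<tau>2 = t2 - (n \<bullet> t2) *\<^sub>R n"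
  have n1: "n \<bullet> n = 1"
    unfolding n_def by (rule norm_N[OF lift_in_S[OF subsetD[OF interior_subset y]]])
  have sh: "shape_operator S N (lift h y) z = - ((z \<bullet> \<tau>1) *\<^sub>R a1 + (z \<bullet> \<tau>2) *\<^sub>R a2)" for z
  proof -
    have "(z - (n \<bullet> z) *\<^sub>R n) \<bullet> t1 = z \<bullet> \<tau>1" "(z - (n \<bullet> z) *\<^sub>R n) \<bullet> t2 = z \<bullet> \<tau>2"
      by (simp_all add: \<tau> inner_diff_left inner_diff_right inner_commute[of n z])
    then show ?thesis
      using linear_eq_partials[OF has_derivative_linear[OF N'], of "proj (z - (n \<bullet> z) *\<^sub>R n)"]
      unfolding shape_operator_def surface_differential_eq[OF y N'] n_def[symmetric]
        a1_def[symmetric] a2_def[symmetric]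
      by simp
  qed
  have "mean_curvature S N (lift h y) = - (\<Sum>i\<in>UNIV. (\<tau>1 $ i) * (a1 $ i) + (\<tau>2 $ i) * (a2 $ i))"
    unfolding mean_curvature_def trace_def matrix_def
    by (simp add: sh inner_axis' flip: sum_negf)
  also have "\<dots> = - (\<tau>1 \<bullet> a1 + \<tau>2 \<bullet> a2)" by (simp add: inner_vec_def sum.distrib)
  finally show "mean_curvature S N (lift h y) = - (a1 \<bullet> t1 + a2 \<bullet> t2)"
    by (simp add: \<tau> inner_diff_left na inner_commute[of t1] inner_commute[of t2])
  have "sff_norm_sq S N (lift h y) =
    (\<Sum>a\<in>Basis. shape_operator S N (lift h y) a \<bullet> shape_operator S N (lift h y) a)"
  proof -
    have "(\<Sum>b\<in>Basis. (x \<bullet> b)\<^sup>2) = x \<bullet> x" for x :: "real^3"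
      by (simp add: euclidean_inner[of x x] power2_eq_square)
    then show ?thesis by (simp add: sff_norm_sq_def second_fundamental_form_def)
  qed
  also have "\<dots> = (\<Sum>a\<in>Basis. (\<tau>1 \<bullet> a) * (\<tau>1 \<bullet> a) * (a1 \<bullet> a1) + 2 * ((\<tau>1 \<bullet> a) * (\<tau>2 \<bullet> a)) * (a1 \<bullet> a2)
      + (\<tau>2 \<bullet> a) * (\<tau>2 \<bullet> a) * (a2 \<bullet> a2))"
    unfolding sh
    by (intro sum.cong refl)
      (simp add: inner_add_left inner_add_right inner_commute[of _ \<tau>1] inner_commute[of _ \<tau>2]
        inner_commute[of a2 a1] algebra_simps)
  also have "\<dots> = (\<tau>1 \<bullet> \<tau>1) * (a1 \<bullet> a1) + 2 * (\<tau>1 \<bullet> \<tau>2) * (a1 \<bullet> a2) + (\<tau>2 \<bullet> \<tau>2) * (a2 \<bullet> a2)"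
    by (simp add: sum.distrib sum_distrib_right[symmetric] sum_distrib_left[symmetric]
        euclidean_inner[of \<tau>1 \<tau>1] euclidean_inner[of \<tau>1 \<tau>2] euclidean_inner[of \<tau>2 \<tau>2])
  finally have eq: "sff_norm_sq S N (lift h y) =
    (\<tau>1 \<bullet> \<tau>1) * (a1 \<bullet> a1) + 2 * (\<tau>1 \<bullet> \<tau>2) * (a1 \<bullet> a2) + (\<tau>2 \<bullet> \<tau>2) * (a2 \<bullet> a2)" .
  have \<tau>\<tau>: "\<tau>1 \<bullet> \<tau>1 = 1 - (n \<bullet> t1)\<^sup>2" "\<tau>1 \<bullet> \<tau>2 = - ((n \<bullet> t1) * (n \<bullet> t2))" "\<tau>2 \<bullet> \<tau>2 = 1 - (n \<bullet> t2)\<^sup>2"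
    using n1 by (simp_all add: \<tau> inner_diff_left inner_diff_right frame_simps inner_commute[of t1 n]
        inner_commute[of t2 n] power2_eq_square)
  show "sff_norm_sq S N (lift h y) =
      (1 - (n \<bullet> t1)\<^sup>2) * (a1 \<bullet> a1) - 2 * ((n \<bullet> t1) * (n \<bullet> t2)) * (a1 \<bullet> a2) + (1 - (n \<bullet> t2)\<^sup>2) * (a2 \<bullet> a2)"
    unfolding eq \<tau>\<tau> by simp
qed

end

section \<open>The flux whose divergence bounds the second variation\<close>

lemma has_derivative_locally_const:
  assumes "(f has_derivative f') (at x)" "open V" "x \<in> V" "\<And>y. y \<in> V \<Longrightarrow> f y = c"
  shows "f' k = 0"
proof -
  have "((\<lambda>_. c) has_derivative f') (at x)"
    by (rule has_derivative_transform_within_open[OF assms(1-3)]) (rule assms(4))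
  then have "f' = (\<lambda>_. 0)" by (rule has_derivative_unique) (rule has_derivative_const)
  then show ?thesis by simp
qed

context orthonormal_frame
begin

text \<open>For \<open>t \<in> {t1, t2}\<close> this is the coordinate component of the vector field
  \<open>u\<^sup>2 \<nabla>\<psi> / \<psi>\<close> with \<open>\<psi> = n \<bullet> e > 0\<close>, multiplied by the density \<open>exp (\<phi>) / \<psi>\<close> of the
  weighted area. It is expressed through the Gauss map alone: \<open>\<nabla>\<psi>\<close> has the component
  \<open>- \<psi> \<Sum>\<^sub>k (n \<bullet> t\<^sub>k) (\<partial>\<^sub>k n \<bullet> t)\<close>, so that second derivatives of \<open>h\<close> do not occur. The arguments
  \<open>h\<close>, \<open>n\<close>, \<open>u\<close> are parameters because the formula is also needed for local smooth extensions
  of these functions across the boundary of \<open>\<Omega>\<close>.\<close>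

definition flux ::
    "real^3 \<Rightarrow> (real^2 \<Rightarrow> real) \<Rightarrow> (real^2 \<Rightarrow> real^3) \<Rightarrow> (real^2 \<Rightarrow> real) \<Rightarrow> real^3 \<Rightarrow> real^2 \<Rightarrow> real" where
  "flux v h n u t y = - (exp (lift h y \<bullet> v) * (u y * u y) *
      ((n y \<bullet> t1) * (partial 1 n y \<bullet> t) + (n y \<bullet> t2) * (partial 2 n y \<bullet> t)) * inverse (n y \<bullet> e))"

lemma Ck_on_lift:
  assumes "open V" "Ck_on k V h"
  shows "Ck_on k V (lift h)"
  unfolding lift_def[abs_def]
  by (intro Ck_on_add assms Ck_on_scaleR[OF assms Ck_on_const] Ck_on_bounded_linear
      bounded_linear_scaleR_const bounded_linear_vec_nth)

text \<open>The factor \<open>u\<^sup>2\<close> is left out: its zeros, not the smoothness of the remaining factors, control the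
  flux at the boundary.\<close>

lemma Ck_on_flux_factors:
  assumes V: "open V" and "\<And>k. Ck_on k V h" "\<And>k. Ck_on k V n" "\<And>y. y \<in> V \<Longrightarrow> n y \<bullet> e \<noteq> 0"
  shows "Ck_on k V (\<lambda>y. exp (lift h y \<bullet> v) *
     ((n y \<bullet> t1) * (partial 1 n y \<bullet> t) + (n y \<bullet> t2) * (partial 2 n y \<bullet> t)) * inverse (n y \<bullet> e))"
proof -
  have p: "Ck_on k V (\<lambda>y. partial i n y)" for i
    by (rule Ck_on_directional_derivative[OF assms(3)])
  have "Ck_on k V (\<lambda>y. exp (lift h y \<bullet> v))"
    by (rule Ck_on_compose[OF V open_UNIV Ck_on_exp])
      (auto intro!: Ck_on_inner Ck_on_lift Ck_on_const assms)
  moreover have "Ck_on k V (\<lambda>y. inverse (n y \<bullet> e))"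
    by (rule Ck_on_compose[OF V _ Ck_on_inverse])
      (use assms(4) in \<open>auto intro!: Ck_on_inner Ck_on_const V assms(3)\<close>)
  ultimately show ?thesis
    by (intro Ck_on_mult Ck_on_add Ck_on_inner p Ck_on_const V assms(3))
qed

lemma flux_partial:
  assumes h: "(h has_derivative h') (at y)" and n: "(n has_derivative n') (at y)"
    and u: "(u has_derivative u') (at y)"
    and n2: "\<And>j. (partial j n has_derivative n2 j) (at y)" and n3: "n y \<bullet> e \<noteq> 0"
  shows "(flux v h n u t has_derivative (\<lambda>d. - (exp (lift h y \<bullet> v) * inverse (n y \<bullet> e) *
    ((lift h' d \<bullet> v) * (u y)\<^sup>2 * ((n y \<bullet> t1) * (partial 1 n y \<bullet> t) + (n y \<bullet> t2) * (partial 2 n y \<bullet> t))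
     + 2 * u y * u' d * ((n y \<bullet> t1) * (partial 1 n y \<bullet> t) + (n y \<bullet> t2) * (partial 2 n y \<bullet> t))
     + (u y)\<^sup>2 * ((n' d \<bullet> t1) * (partial 1 n y \<bullet> t) + (n' d \<bullet> t2) * (partial 2 n y \<bullet> t)
        + (n y \<bullet> t1) * (n2 1 d \<bullet> t) + (n y \<bullet> t2) * (n2 2 d \<bullet> t))
     - (u y)\<^sup>2 * ((n y \<bullet> t1) * (partial 1 n y \<bullet> t) + (n y \<bullet> t2) * (partial 2 n y \<bullet> t)) *
        ((n' d \<bullet> e) * inverse (n y \<bullet> e)))))) (at y)"
proof -
  have E: "((\<lambda>y. exp (lift h y \<bullet> v)) has_derivative (\<lambda>d. (lift h' d \<bullet> v) * exp (lift h y \<bullet> v))) (at y)"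
    by (intro has_derivative_exp has_derivative_inner_left lift_has_derivative h)
  have Q: "((\<lambda>y. (n y \<bullet> t1) * (partial 1 n y \<bullet> t) + (n y \<bullet> t2) * (partial 2 n y \<bullet> t)) has_derivative
    (\<lambda>d. ((n y \<bullet> t1) * (n2 1 d \<bullet> t) + (n' d \<bullet> t1) * (partial 1 n y \<bullet> t)) +
      ((n y \<bullet> t2) * (n2 2 d \<bullet> t) + (n' d \<bullet> t2) * (partial 2 n y \<bullet> t)))) (at y)"
    by (intro has_derivative_add has_derivative_mult has_derivative_inner_left n n2)
  have W: "((\<lambda>y. inverse (n y \<bullet> e)) has_derivative
      (\<lambda>d. - (inverse (n y \<bullet> e) * (n' d \<bullet> e) * inverse (n y \<bullet> e)))) (at y)"
    by (intro Deriv.has_derivative_inverse has_derivative_inner_left n n3)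
  show ?thesis
    unfolding flux_def[abs_def]
    by (rule has_derivative_eq_rhs,
        rule has_derivative_minus[OF has_derivative_mult[OF has_derivative_mult[OF
          has_derivative_mult[OF E has_derivative_mult[OF u u]] Q] W]])
      (simp add: fun_eq_iff power2_eq_square algebra_simps)
qed

end

context graph_surface
begin

abbreviation gauss_param :: "real^2 \<Rightarrow> real^3" where
  "gauss_param y \<equiv> N (lift h y)"

lemma smooth_on_gauss_param: "smooth_on \<Omega> gauss_param"
  by (rule smooth_on_compose[of S]) (use gauss smooth_on_lift[OF smooth_h] lift_in_S in \<open>auto simp: gauss_map_def\<close>)

lemma interior_subset_\<Omega>: "y \<in> interior \<Omega> \<Longrightarrow> y \<in> \<Omega>"
  by (rule subsetD[OF interior_subset])

text \<open>The weighted divergence of \<open>u\<^sup>2 \<nabla>\<psi> / \<psi>\<close> is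
  \<open>2 u \<langle>\<nabla>u, \<nabla>\<psi>\<rangle> / \<psi> - u\<^sup>2 |\<nabla>\<psi>|\<^sup>2 / \<psi>\<^sup>2 + u\<^sup>2 (\<Delta>\<psi> + \<langle>\<nabla>\<psi>, v\<rangle>) / \<psi>\<close>, the Jacobi
  equation turns the last term into \<open>- |A|\<^sup>2 u\<^sup>2\<close>, and completing the square bounds the rest by
  \<open>|\<nabla>u|\<^sup>2\<close>. The Jacobi equation itself is the derivative of the soliton equation combined with
  \<open>\<partial>\<^sub>i \<partial>\<^sub>k n = \<partial>\<^sub>k \<partial>\<^sub>i n\<close>.\<close>

lemma divergence_flux_le:
  assumes soliton: "\<And>p. p \<in> S \<Longrightarrow> mean_curvature S N p = N p \<bullet> v + l"
    and y: "y \<in> interior \<Omega>" and pos: "N (lift h y) \<bullet> e > 0"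
    and u: "smooth_on \<Omega> u" "\<And>y. y \<in> \<Omega> \<Longrightarrow> f (lift h y) = u y"
  shows "partial 1 (flux v h gauss_param u t1) y + partial 2 (flux v h gauss_param u t2) y
    \<le> ((norm (surface_gradient S f (lift h y)))\<^sup>2 - sff_norm_sq S N (lift h y) * (f (lift h y))\<^sup>2) *
      (exp (lift h y \<bullet> v) / (N (lift h y) \<bullet> e))"
proof -
  let ?n = gauss_param
  note op = open_interior[of \<Omega>]
  have Ckn: "Ck_on k (interior \<Omega>) ?n" for k
    by (rule smooth_on_imp_Ck_on_interior[OF smooth_on_gauss_param])
  have Ckh: "Ck_on k (interior \<Omega>) h" for k by (rule smooth_on_imp_Ck_on_interior[OF smooth_h])
  have Cku: "Ck_on k (interior \<Omega>) u" for k by (rule smooth_on_imp_Ck_on_interior[OF u(1)])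
  note dn = Ck_on_has_derivative[OF Ckn] and dh = Ck_on_has_derivative[OF Ckh]
    and du = Ck_on_has_derivative[OF Cku]
    and dn2 = Ck_on_has_derivative[OF Ck_on_directional_derivative[OF Ckn]]
    and dh2 = Ck_on_has_derivative[OF Ck_on_directional_derivative[OF Ckh]]
  define n a1 a2 where na_def: "n = ?n y" "a1 = partial 1 ?n y" "a2 = partial 2 ?n y"
  define b where "b i j = partial i (\<lambda>y. partial j ?n y) y" for i j
  define h1 h2 where hh: "h1 = partial 1 h y" "h2 = partial 2 h y"
  define G1 G2 where G: "G1 = t1 + h1 *\<^sub>R e" "G2 = t2 + h2 *\<^sub>R e"
  define g where "g = surface_gradient S f (lift h y)"
  have y\<Omega>: "y \<in> \<Omega>" by (rule interior_subset_\<Omega>[OF y])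
  have n3: "n \<bullet> e \<noteq> 0" using pos by (simp add: na_def)
  have n1: "n \<bullet> n = 1" unfolding na_def by (rule norm_N[OF lift_in_S[OF y\<Omega>]])
  have liftG: "lift (frechet_derivative h (at z)) (axis 1 1) = t1 + partial 1 h z *\<^sub>R e"
    "lift (frechet_derivative h (at z)) (axis 2 1) = t2 + partial 2 h z *\<^sub>R e" for z
    by (simp_all add: lift_def axis_def)
  have tang: "?n z \<bullet> (t1 + partial 1 h z *\<^sub>R e) = 0" "?n z \<bullet> (t2 + partial 2 h z *\<^sub>R e) = 0"
    if "z \<in> interior \<Omega>" for z
    using lift_derivative_tangent[OF interior_subset_\<Omega>[OF that] has_derivative_at_withinI[OF dh[OF that]]]
      liftG by metis+
  have nG: "n \<bullet> G1 = 0" "n \<bullet> G2 = 0" using tang[OF y] by (simp_all add: na_def hh G)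
  have na_all: "?n z \<bullet> frechet_derivative ?n (at z) k = 0" if z: "z \<in> interior \<Omega>" for z k
  proof -
    have "?n z \<bullet> frechet_derivative ?n (at z) k + frechet_derivative ?n (at z) k \<bullet> ?n z = 0"
      by (rule has_derivative_locally_const[OF has_derivative_inner[OF dn[OF z] dn[OF z]] op z, of 1])
        (rule norm_N[OF lift_in_S[OF interior_subset_\<Omega>]])
    then show ?thesis by (simp add: inner_commute)
  qed
  from na_all[OF y] have na: "n \<bullet> a1 = 0" "n \<bullet> a2 = 0" by (simp_all add: na_def)
  \<comment> \<open>Differentiating the tangency relations expresses the second fundamental form by the Hessian
    of \<open>h\<close>, whose symmetry makes the shape operator self-adjoint.\<close>
  have tang': "frechet_derivative ?n (at y) k \<bullet> G1 + (n \<bullet> e) * frechet_derivative (partial 1 h) (at y) k = 0"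
    "frechet_derivative ?n (at y) k \<bullet> G2 + (n \<bullet> e) * frechet_derivative (partial 2 h) (at y) k = 0" for k
  proof -
    have d: "((\<lambda>z. ?n z \<bullet> (t + partial i h z *\<^sub>R e)) has_derivative
       (\<lambda>k. ?n y \<bullet> (0 + frechet_derivative (partial i h) (at y) k *\<^sub>R e) +
         frechet_derivative ?n (at y) k \<bullet> (t + partial i h y *\<^sub>R e))) (at y)" for t i
      by (intro has_derivative_inner dn[OF y] has_derivative_add has_derivative_const
          has_derivative_scaleR_left dh2[OF y])
    show "frechet_derivative ?n (at y) k \<bullet> G1 + (n \<bullet> e) * frechet_derivative (partial 1 h) (at y) k = 0"
      "frechet_derivative ?n (at y) k \<bullet> G2 + (n \<bullet> e) * frechet_derivative (partial 2 h) (at y) k = 0"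
      using has_derivative_locally_const[OF d[of t1 1] op y tang(1), of k]
        has_derivative_locally_const[OF d[of t2 2] op y tang(2), of k]
      by (simp_all add: na_def hh G mult.commute)
  qed
  have "partial 1 (partial 2 h) y = partial 2 (partial 1 h) y"
    by (rule Ck_on_second_derivative_symmetric[OF op y Ckh])
  then have sym: "a1 \<bullet> G2 = a2 \<bullet> G1"
    using tang'(1)[of "axis 2 1"] tang'(2)[of "axis 1 1"] by (simp add: na_def)
  have bsym: "b i j = b j i" for i j
    unfolding b_def by (rule Ck_on_second_derivative_symmetric_inner[OF op y Ckn])
  have H: "partial 1 ?n z \<bullet> t1 + partial 2 ?n z \<bullet> t2 + ?n z \<bullet> v = - l" if z: "z \<in> interior \<Omega>" for z
    using mean_curvature_eq[OF z dn[OF z] na_all[OF z] na_all[OF z]]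
      soliton[OF lift_in_S[OF interior_subset_\<Omega>[OF z]]] by simp
  have H': "frechet_derivative (partial 1 ?n) (at y) k \<bullet> t1 + frechet_derivative (partial 2 ?n) (at y) k \<bullet> t2
      + frechet_derivative ?n (at y) k \<bullet> v = 0" for k
    by (rule has_derivative_locally_const[of "\<lambda>z. partial 1 ?n z \<bullet> t1 + partial 2 ?n z \<bullet> t2 + ?n z \<bullet> v",
          OF _ op y H])
      (intro has_derivative_add has_derivative_inner_left dn[OF y] dn2[OF y])
  \<comment> \<open>The soliton equation differentiated in the two coordinate directions, with the order of
    the second derivatives of the Gauss map exchanged.\<close>
  have H1: "b 1 1 \<bullet> t1 + b 2 1 \<bullet> t2 = - (a1 \<bullet> v)" "b 1 2 \<bullet> t1 + b 2 2 \<bullet> t2 = - (a2 \<bullet> v)"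
    using H'[of "axis 1 1"] H'[of "axis 2 1"] bsym[of 1 2] by (simp_all add: b_def na_def)
  have du': "((\<lambda>y. f (lift h y)) has_derivative frechet_derivative u (at y)) (at y)"
    by (rule has_derivative_transform_within_open[OF du[OF y] op y]) (simp add: u(2) interior_subset_\<Omega>)
  have ng: "n \<bullet> g = 0" unfolding g_def na_def by (rule surface_gradient_eq(1)[OF y du'])
  have pG: "proj G1 = axis 1 1" "proj G2 = axis 2 1"
    by (simp_all add: vec_eq_iff forall_2 G inner_add_left frame_simps axis_def)
  have gG: "g \<bullet> G1 = partial 1 u y" "g \<bullet> G2 = partial 2 u y"
    using surface_gradient_eq(2)[OF y du', of G1] surface_gradient_eq(2)[OF y du', of G2] nG pG
    by (simp_all add: g_def na_def)
  define q1 q2 where q: "q1 = (n \<bullet> t1) * (a1 \<bullet> t1) + (n \<bullet> t2) * (a2 \<bullet> t1)"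
    "q2 = (n \<bullet> t1) * (a1 \<bullet> t2) + (n \<bullet> t2) * (a2 \<bullet> t2)"
  define E w where Ew: "E = exp (lift h y \<bullet> v)" "w = inverse (n \<bullet> e)"
  define A where "A = sff_norm_sq S N (lift h y)"
  have A: "A = (a1 \<bullet> t1)\<^sup>2 + 2 * ((a1 \<bullet> t2) * (a2 \<bullet> t1)) + (a2 \<bullet> t2)\<^sup>2"
    using sff_norm_sq_eq[OF y dn[OF y] na_all[OF y] na_all[OF y]]
      shape_operator_identities(1)[OF n3 n1, of h1 h2 a1 a2, folded G, OF nG na sym]
    by (simp add: A_def na_def)
  \<comment> \<open>The derivative of the weight \<open>exp (\<phi>)\<close> produces the left-hand side, the soliton equation
    the right-hand side; they cancel in the divergence.\<close>
  have drift: "(G1 \<bullet> v) * q1 + (G2 \<bullet> v) * q2 = (n \<bullet> t1) * (a1 \<bullet> v) + (n \<bullet> t2) * (a2 \<bullet> v)"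
  proof -
    have "n \<bullet> ((n \<bullet> t1) *\<^sub>R a1 + (n \<bullet> t2) *\<^sub>R a2) = 0" by (simp add: inner_add_right na)
    from tangent_frame_expand[OF n3 n1, of h1 h2, folded G, OF nG this]
    have "(n \<bullet> t1) *\<^sub>R a1 + (n \<bullet> t2) *\<^sub>R a2 = q1 *\<^sub>R G1 + q2 *\<^sub>R G2"
      by (simp add: inner_add_left q)
    from arg_cong[OF this, of "\<lambda>x. x \<bullet> v"] show ?thesis
      by (simp add: inner_add_left mult.commute)
  qed
  have fl: "partial i (flux v h ?n u t) y = - (E * w *
    ((lift (frechet_derivative h (at y)) (axis i 1) \<bullet> v) * (u y)\<^sup>2 * ((n \<bullet> t1) * (a1 \<bullet> t) + (n \<bullet> t2) * (a2 \<bullet> t))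
     + 2 * u y * partial i u y * ((n \<bullet> t1) * (a1 \<bullet> t) + (n \<bullet> t2) * (a2 \<bullet> t))
     + (u y)\<^sup>2 * ((partial i ?n y \<bullet> t1) * (a1 \<bullet> t) + (partial i ?n y \<bullet> t2) * (a2 \<bullet> t)
        + (n \<bullet> t1) * (b i 1 \<bullet> t) + (n \<bullet> t2) * (b i 2 \<bullet> t))
     - (u y)\<^sup>2 * ((n \<bullet> t1) * (a1 \<bullet> t) + (n \<bullet> t2) * (a2 \<bullet> t)) * ((partial i ?n y \<bullet> e) * w)))" for i t
  proof -
    note fp = flux_partial[where v = v and t = t, OF dh[OF y] dn[OF y] du[OF y] dn2[OF y] n3[unfolded na_def]]
    show ?thesis
      unfolding frechet_derivative_at[OF fp, symmetric] by (simp add: b_def na_def Ew)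
  qed
  have "partial 1 (flux v h ?n u t1) y + partial 2 (flux v h ?n u t2) y = - (E * w *
    ((u y)\<^sup>2 * ((G1 \<bullet> v) * q1 + (G2 \<bullet> v) * q2) + 2 * u y * (q1 * partial 1 u y + q2 * partial 2 u y)
     + (u y)\<^sup>2 * A + (u y)\<^sup>2 * ((n \<bullet> t1) * (b 1 1 \<bullet> t1 + b 2 1 \<bullet> t2) + (n \<bullet> t2) * (b 1 2 \<bullet> t1 + b 2 2 \<bullet> t2))
     - (u y)\<^sup>2 * (q1 * (a1 \<bullet> e) + q2 * (a2 \<bullet> e)) * w))"
    unfolding fl liftG A q na_def(2,3)[symmetric] hh[symmetric] G[symmetric]
    by (simp add: power2_eq_square algebra_simps)
  also have "\<dots> = (- (2 * u y * (q1 * (g \<bullet> G1) + q2 * (g \<bullet> G2)))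
      + (u y)\<^sup>2 * (q1 * (a1 \<bullet> e) + q2 * (a2 \<bullet> e)) / (n \<bullet> e) - A * (u y)\<^sup>2) * (E * w)"
    unfolding H1 drift gG by (simp add: Ew divide_inverse algebra_simps)
  also have "\<dots> \<le> ((norm g)\<^sup>2 - A * (u y)\<^sup>2) * (E * w)"
    using stability_density_inequality[OF n3 n1, of h1 h2 a1 a2 g "u y", folded G q, OF nG na sym ng] pos
    by (intro mult_right_mono) (simp_all add: Ew na_def)
  also have "E * w = exp (lift h y \<bullet> v) / (N (lift h y) \<bullet> e)" by (simp add: Ew na_def divide_inverse)
  finally show ?thesis using u(2)[OF y\<Omega>] by (simp add: g_def A_def)
qed

end

context graph_surface
begin

text \<open>A point that is not on the boundary of \<open>S\<close> lies in an interior chart, whose projection to the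
  plane is open by invariance of domain. Hence test functions vanish at all points over
  \<open>\<Omega> - interior \<Omega>\<close>.\<close>

lemma lift_in_boundary:
  assumes y: "y \<in> \<Omega>" "y \<notin> interior \<Omega>"
  shows "lift h y \<in> surface_boundary S"
proof -
  obtain U x q where U: "local_param S U x" "q \<in> U" and xq: "x q = lift h y"
    using chart_at[OF lift_in_S[OF y(1)]] by metis
  have U': "openin (top_of_set half_plane) U" using U(1) by (simp add: local_param_def)
  have xS: "x r \<in> S" if "r \<in> U" for r
    using U(1) that openin_imp_subset unfolding local_param_def by blast
  have "q $ 1 = 0"
  proof (rule ccontr)
    assume "q $ 1 \<noteq> 0"
    moreover have "0 \<le> q $ 1" using U' U(2) openin_imp_subset by (fastforce simp: half_plane_def)
    ultimately have q1: "q $ 1 > 0" by simp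
    obtain T where T: "open T" "U = half_plane \<inter> T" using U' by (auto simp: openin_open)
    define V where "V = T \<inter> {q. 0 < q $ 1}"
    have V: "open V" "q \<in> V" "V \<subseteq> U"
      using T U(2) q1
      by (auto simp: V_def half_plane_def intro!: open_Int open_Collect_less continuous_intros)
    obtain z where z: "\<And>q. q \<in> U \<Longrightarrow> z (x q) = q" using U(1) unfolding local_param_def by auto
    have "continuous_on U x" using U(1) smooth_on_imp_continuous_on by (auto simp: local_param_def)
    then have "continuous_on V (\<lambda>r. proj (x r))"
      using continuous_on_subset[OF _ V(3)] linear_continuous_on[OF bounded_linear_proj]
      by (auto intro: continuous_on_compose2)
    moreover have "inj_on (\<lambda>r. proj (x r)) V"
    proof (rule inj_onI)
      fix r s assume rs: "r \<in> V" "s \<in> V" "proj (x r) = proj (x s)"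
      then have "r \<in> U" "s \<in> U" using V(3) by auto
      then have "x r = x s" using rs(3) lift_proj xS by metis
      then show "r = s" using z \<open>r \<in> U\<close> \<open>s \<in> U\<close> by metis
    qed
    ultimately have "open ((\<lambda>r. proj (x r)) ` V)" using invariance_of_domain V(1) by blast
    moreover have "(\<lambda>r. proj (x r)) ` V \<subseteq> \<Omega>" using V(3) xS proj_in_\<Omega> by auto
    moreover have "y \<in> (\<lambda>r. proj (x r)) ` V" using V(2) xq by (metis image_eqI proj_lift)
    ultimately show False using y(2) interiorI by blast
  qed
  then show ?thesis using U xq unfolding surface_boundary_def by (auto intro!: exI)
qed

text \<open>At points of \<open>\<Omega> - interior \<Omega>\<close> the flux extends smoothly and, being quadratic in \<open>u\<close>, vanishes
  together with its first derivatives; near points outside \<open>\<Omega>\<close> it vanishes because \<open>u\<close> has compact support in \<open>\<Omega>\<close>.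
  So integration by parts leaves no boundary term.\<close>

lemma
  fixes v t :: "real^3" and f :: "real^3 \<Rightarrow> real"
  assumes f: "test_function S f"
  defines "u \<equiv> \<lambda>y. f (lift h y)"
  defines "F \<equiv> \<lambda>y. if y \<in> interior \<Omega> then flux v h gauss_param u t y else 0"
  shows Ck_on_flux_extension: "Ck_on (Suc 0) UNIV F"
    and flux_extension_derivative_outside: "y \<notin> interior \<Omega> \<Longrightarrow> frechet_derivative F (at y) k = 0"
    and flux_extension_compact_support: "\<exists>K. compact K \<and> (\<forall>y. y \<notin> K \<longrightarrow> F y = 0)"
proof -
  have smu: "smooth_on \<Omega> u" unfolding u_def
    by (rule smooth_on_compose[of S])
      (use f smooth_on_lift[OF smooth_h] lift_in_S in \<open>auto simp: test_function_def\<close>)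
  obtain K where K: "compact K" "K \<subseteq> S" "\<And>p. p \<in> S - K \<Longrightarrow> f p = 0"
    using f unfolding test_function_def by blast
  define K' where "K' = proj ` K"
  have K'c: "compact K'" unfolding K'_def
    by (rule compact_continuous_image[OF linear_continuous_on[OF bounded_linear_proj] K(1)])
  have K'\<Omega>: "K' \<subseteq> \<Omega>" using K(2) proj_in_\<Omega> by (auto simp: K'_def)
  have u0: "u y = 0" if "y \<in> \<Omega>" "y \<notin> K'" for y
  proof -
    have "lift h y \<notin> K" using that(2) unfolding K'_def by (metis image_eqI proj_lift)
    then show ?thesis using K(3) lift_in_S[OF that(1)] by (simp add: u_def)
  qed
  have F0: "F y = 0" if "y \<notin> K'" for y
    using u0[OF interior_subset_\<Omega>] that by (simp add: F_def flux_def)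
  then show "\<exists>K. compact K \<and> (\<forall>y. y \<notin> K \<longrightarrow> F y = 0)" using K'c by blast
  have near: "\<exists>V g. open V \<and> x \<in> V \<and> Ck_on (Suc 0) V g \<and> g x = 0 \<and>
      (\<forall>k. frechet_derivative g (at x) k = 0) \<and> (\<forall>y\<in>V \<inter> interior \<Omega>. F y = g y)"
    if x: "x \<notin> interior \<Omega>" for x
  proof (cases "x \<in> \<Omega>")
    case False
    show ?thesis
      by (rule exI[of _ "- K'"], rule exI[of _ "\<lambda>_. 0"])
        (use False K'\<Omega> K'c F0 Ck_on_const[of "- K'" "Suc 0" 0] in
          \<open>auto simp del: Ck_on.simps intro: open_Compl compact_imp_closed\<close>)
  next
    case True
    have ux: "u x = 0"
      using f lift_in_boundary[OF True x] by (simp add: test_function_def u_def)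
    obtain V1 h' where V1: "open V1" "x \<in> V1" "\<And>k. Ck_on k V1 h'" "\<And>y. y \<in> V1 \<inter> \<Omega> \<Longrightarrow> h' y = h y"
      using smooth_onE[OF smooth_h True] by metis
    obtain V2 n' where V2: "open V2" "x \<in> V2" "\<And>k. Ck_on k V2 n'"
      "\<And>y. y \<in> V2 \<inter> \<Omega> \<Longrightarrow> n' y = gauss_param y"
      using smooth_onE[OF smooth_on_gauss_param True] by metis
    obtain V3 u' where V3: "open V3" "x \<in> V3" "\<And>k. Ck_on k V3 u'" "\<And>y. y \<in> V3 \<inter> \<Omega> \<Longrightarrow> u' y = u y"
      using smooth_onE[OF smu True] by metis
    define V where "V = V1 \<inter> (V2 \<inter> (\<lambda>y. n' y \<bullet> e) -` (- {0})) \<inter> V3"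
    have "continuous_on V2 (\<lambda>y. n' y \<bullet> e)"
      by (intro continuous_intros Ck_on_continuous[OF V2(3)[of 0]])
    then have opV: "open V"
      unfolding V_def by (intro open_Int V1(1) V3(1) continuous_open_preimage V2(1)) auto
    have xV: "x \<in> V"
      using V1(2) V2(2) V3(2) V2(4)[of x] True N_e_nonzero[OF lift_in_S[OF True]] by (simp add: V_def)
    have h': "Ck_on k V h'" for k by (rule Ck_on_subset[OF V1(3)]) (auto simp: V_def)
    have n': "Ck_on k V n'" for k by (rule Ck_on_subset[OF V2(3)]) (auto simp: V_def)
    have u': "Ck_on k V u'" for k by (rule Ck_on_subset[OF V3(3)]) (auto simp: V_def)
    have n'e: "n' y \<bullet> e \<noteq> 0" if "y \<in> V" for y using that by (simp add: V_def)
    let ?g = "flux v h' n' u' t"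
    have u'x: "u' x = 0" using V3(4)[of x] True V3(2) ux by simp
    have "Ck_on (Suc 0) V (\<lambda>y. - ((u' y * u' y) * (exp (lift h' y \<bullet> v) *
     ((n' y \<bullet> t1) * (partial 1 n' y \<bullet> t) + (n' y \<bullet> t2) * (partial 2 n' y \<bullet> t)) * inverse (n' y \<bullet> e))))"
      by (intro Ck_on_minus Ck_on_mult opV u' Ck_on_flux_factors h' n' n'e)
    then have Ckg: "Ck_on (Suc 0) V ?g"
      by (rule Ck_on_cong[OF opV, rotated]) (simp add: flux_def)
    have "frechet_derivative ?g (at x) k = 0" for k
      using flux_partial[where v = v and t = t, OF Ck_on_has_derivative[OF h' xV]
          Ck_on_has_derivative[OF n' xV] Ck_on_has_derivative[OF u' xV]
          Ck_on_has_derivative[OF Ck_on_directional_derivative[OF n'] xV] n'e[OF xV]]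
      unfolding u'x by (simp add: frechet_derivative_at[symmetric])
    moreover have "F y = ?g y" if y: "y \<in> V \<inter> interior \<Omega>" for y
    proof -
      have y\<Omega>: "y \<in> \<Omega>" using y interior_subset by blast
      have eq: "gauss_param z = n' z" if "z \<in> V \<inter> interior \<Omega>" for z
        using that V2(4)[of z] interior_subset_\<Omega>[of z] by (auto simp: V_def)
      have "frechet_derivative gauss_param (at y) = frechet_derivative n' (at y)"
      proof (rule frechet_derivative_transform_within_open[where X = "V \<inter> interior \<Omega>"])
        show "gauss_param differentiable at y"
          using smooth_on_imp_Ck_on_interior[OF smooth_on_gauss_param, of "Suc 0"] y by simp
      qed (use y opV eq in auto)
      moreover have "u' y = u y" "h' y = h y"
        using V1(4)[of y] V3(4)[of y] y\<Omega> y by (auto simp: V_def)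
      ultimately show ?thesis using eq[OF y] y by (simp add: F_def flux_def lift_def)
    qed
    ultimately show ?thesis
      using opV xV Ckg u'x by (intro exI[of _ V] exI[of _ ?g]) (auto simp: flux_def simp del: Ck_on.simps)
  qed
  have CkF: "Ck_on (Suc 0) (interior \<Omega>) F"
  proof -
    have i: "Ck_on k (interior \<Omega>) h" "Ck_on k (interior \<Omega>) gauss_param" "Ck_on k (interior \<Omega>) u" for k
      by (intro smooth_on_imp_Ck_on_interior smooth_h smooth_on_gauss_param smu)+
    have "Ck_on (Suc 0) (interior \<Omega>) (\<lambda>y. - ((u y * u y) * (exp (lift h y \<bullet> v) *
      ((gauss_param y \<bullet> t1) * (partial 1 gauss_param y \<bullet> t) + (gauss_param y \<bullet> t2) * (partial 2 gauss_param y \<bullet> t)) *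
        inverse (gauss_param y \<bullet> e))))"
      by (intro Ck_on_minus Ck_on_mult open_interior i Ck_on_flux_factors
          N_e_nonzero lift_in_S interior_subset_\<Omega>)
    then show ?thesis
      by (rule Ck_on_cong[OF open_interior, rotated]) (simp add: flux_def F_def)
  qed
  have Fout: "F x = 0" if "x \<notin> interior \<Omega>" for x using that by (simp add: F_def)
  show "Ck_on (Suc 0) UNIV F"
    by (rule Ck_on_1_extension_by_zero(1)[OF open_interior CkF Fout near])
  show "y \<notin> interior \<Omega> \<Longrightarrow> frechet_derivative F (at y) k = 0"
    by (rule Ck_on_1_extension_by_zero(2)[OF open_interior CkF Fout near])
qed

end

section \<open>The area measure\<close>

text \<open>The absolutely integrable case is the change of variables theorem; otherwise both sides are
  infinite, and measurability of the two integrands is needed to conclude this.\<close>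

lemma nn_integral_change_of_variables:
  fixes g :: "real^'n::{finite,wellorder} \<Rightarrow> real^'n::_" and w :: "real^'n::_ \<Rightarrow> real"
  assumes E: "E \<in> sets lebesgue"
    and der: "\<And>q. q \<in> E \<Longrightarrow> (g has_derivative g' q) (at q within E)"
    and inj: "inj_on g E"
    and w: "(\<lambda>y. indicator (g ` E) y * w y) \<in> borel_measurable lebesgue"
    and D: "(\<lambda>q. indicator E q * (\<bar>det (matrix (g' q))\<bar> * w (g q))) \<in> borel_measurable lebesgue"
    and nonneg: "\<And>y. y \<in> g ` E \<Longrightarrow> 0 \<le> w y"
  shows "(\<integral>\<^sup>+y. ennreal (w y) * indicator (g ` E) y \<partial>lebesgue) =
    (\<integral>\<^sup>+q. ennreal (\<bar>det (matrix (g' q))\<bar> * w (g q)) * indicator E q \<partial>lebesgue)"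
proof -
  define I1 where "I1 y = indicator (g ` E) y * w y" for y
  define I2 where "I2 q = indicator E q * (\<bar>det (matrix (g' q))\<bar> * w (g q))" for q
  have pos: "0 \<le> I1 y" "0 \<le> I2 y" for y
    using nonneg by (auto simp: I1_def I2_def indicator_def)
  have cov: "(\<lambda>q. \<bar>det (matrix (g' q))\<bar> * w (g q)) absolutely_integrable_on E \<and>
      integral E (\<lambda>q. \<bar>det (matrix (g' q))\<bar> * w (g q)) = b \<longleftrightarrow>
      w absolutely_integrable_on g ` E \<and> integral (g ` E) w = b" for b
  proof -
    have "(\<lambda>x. \<bar>det (matrix (g' x))\<bar> *\<^sub>R (vec (w (g x)) :: real^1)) absolutely_integrable_on E \<and>
        integral E (\<lambda>x. \<bar>det (matrix (g' x))\<bar> *\<^sub>R (vec (w (g x)) :: real^1)) = vec b \<longleftrightarrow>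
      (\<lambda>y. vec (w y) :: real^1) absolutely_integrable_on g ` E \<and>
        integral (g ` E) (\<lambda>y. vec (w y) :: real^1) = vec b"
      by (rule has_absolute_integral_change_of_variables[OF E der inj])
    then show ?thesis by (simp add: absolutely_integrable_on_1_iff integral_on_1_eq vec_eq_iff)
  qed
  have int: "integrable lebesgue I1 \<longleftrightarrow> w absolutely_integrable_on g ` E"
    "integrable lebesgue I2 \<longleftrightarrow> (\<lambda>q. \<bar>det (matrix (g' q))\<bar> * w (g q)) absolutely_integrable_on E"
    by (simp_all add: set_integrable_def I1_def[abs_def] I2_def[abs_def])
  have iff: "integrable lebesgue I1 \<longleftrightarrow> integrable lebesgue I2" using cov int by blast
  have "(\<integral>\<^sup>+y. ennreal (I1 y) \<partial>lebesgue) = (\<integral>\<^sup>+q. ennreal (I2 q) \<partial>lebesgue)"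
  proof (cases "integrable lebesgue I2")
    case True
    have "integral\<^sup>L lebesgue I1 = integral (g ` E) w"
      using set_lebesgue_integral_eq_integral(2)[of "g ` E" w] True iff int
      by (simp add: set_lebesgue_integral_def I1_def[abs_def])
    moreover have "integral\<^sup>L lebesgue I2 = integral E (\<lambda>q. \<bar>det (matrix (g' q))\<bar> * w (g q))"
      using set_lebesgue_integral_eq_integral(2)[of E "\<lambda>q. \<bar>det (matrix (g' q))\<bar> * w (g q)"] True int
      by (simp add: set_lebesgue_integral_def I2_def[abs_def])
    moreover have "integral E (\<lambda>q. \<bar>det (matrix (g' q))\<bar> * w (g q)) = integral (g ` E) w"
      using cov True int by blast
    ultimately have "integral\<^sup>L lebesgue I1 = integral\<^sup>L lebesgue I2" by simp
    moreover have "(\<integral>\<^sup>+y. ennreal (I1 y) \<partial>lebesgue) = ennreal (integral\<^sup>L lebesgue I1)"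
      by (rule nn_integral_eq_integral) (use True iff pos in auto)
    moreover have "(\<integral>\<^sup>+y. ennreal (I2 y) \<partial>lebesgue) = ennreal (integral\<^sup>L lebesgue I2)"
      by (rule nn_integral_eq_integral) (use True pos in auto)
    ultimately show ?thesis by simp
  next
    case False
    have "\<not> (\<integral>\<^sup>+y. ennreal (I1 y) \<partial>lebesgue) < \<infinity>"
      using integrableI_nonneg[of I1 lebesgue] False iff w pos by (auto simp: I1_def[abs_def])
    moreover have "\<not> (\<integral>\<^sup>+y. ennreal (I2 y) \<partial>lebesgue) < \<infinity>"
      using integrableI_nonneg[of I2 lebesgue] False D pos by (auto simp: I2_def[abs_def])
    ultimately show ?thesis by (metis infinity_ennreal_def less_top)
  qed
  moreover have "ennreal (I1 y) = ennreal (w y) * indicator (g ` E) y"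
    "ennreal (I2 q) = ennreal (\<bar>det (matrix (g' q))\<bar> * w (g q)) * indicator E q" for y q
    by (auto simp: I1_def I2_def indicator_def)
  ultimately show ?thesis by simp
qed

lemma half_plane_openin_sigma_compact:
  assumes "openin (top_of_set half_plane) U"
  shows "\<exists>C :: nat \<Rightarrow> (real^2) set. (\<forall>n. compact (C n)) \<and> (\<Union>n. C n) = U"
proof -
  obtain T where T: "open T" "U = half_plane \<inter> T" using assms by (auto simp: openin_open)
  have "\<exists>C :: nat \<Rightarrow> (real^2) set. (\<forall>n. compact (C n)) \<and> \<Union>(range C) = T"
    by (rule open_Union_compact_subsets[OF T(1)]) (intro exI conjI allI; assumption)
  then obtain C :: "nat \<Rightarrow> (real^2) set" where C: "\<forall>n. compact (C n)" "\<Union>(range C) = T"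
    by (elim exE conjE)
  have "closed half_plane"
    unfolding half_plane_def by (intro closed_Collect_le continuous_intros)
  then have "compact (half_plane \<inter> C n)" for n using C(1) by (simp add: closed_Int_compact)
  moreover have "(\<Union>n. half_plane \<inter> C n) = U" using C(2) T(2) by auto
  ultimately show ?thesis by (intro exI[of _ "\<lambda>n. half_plane \<inter> C n"]) simp
qed

lemma sigma_compact_borel:
  fixes C :: "nat \<Rightarrow> 'a::euclidean_space set"
  assumes "\<And>n. compact (C n)"
  shows "(\<Union>n. C n) \<in> sets borel"
proof -
  have "C n \<in> sets borel" for n by (rule borel_compact[OF assms])
  then show ?thesis by (intro sets.countable_UN) auto
qed

lemma local_param_continuous_on: "local_param S U x \<Longrightarrow> continuous_on U x"
  by (simp add: local_param_def smooth_on_imp_continuous_on)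

lemma local_param_domain_borel:
  assumes "local_param S U x"
  shows "U \<in> sets borel"
proof -
  have "openin (top_of_set half_plane) U" using assms by (simp add: local_param_def)
  from half_plane_openin_sigma_compact[OF this]
  obtain C :: "nat \<Rightarrow> (real^2) set" where "\<forall>n. compact (C n)" "(\<Union>n. C n) = U"
    by (elim exE conjE)
  then show ?thesis using sigma_compact_borel[of C] by simp
qed

lemma continuous_image_sigma_compact_borel:
  fixes f :: "real^2 \<Rightarrow> 'b::euclidean_space"
  assumes "openin (top_of_set half_plane) U" "continuous_on U f"
  shows "f ` U \<in> sets borel"
proof -
  obtain C :: "nat \<Rightarrow> (real^2) set" where C: "\<forall>n. compact (C n)" "(\<Union>n. C n) = U"
    using half_plane_openin_sigma_compact[OF assms(1)] by (elim exE conjE)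
  have "compact (f ` C n)" for n
    by (rule compact_continuous_image[OF continuous_on_subset[OF assms(2)]]) (use C in auto)
  then have "(\<Union>n. f ` C n) \<in> sets borel" by (rule sigma_compact_borel)
  moreover have "(\<Union>n. f ` C n) = f ` U" using C(2) by auto
  ultimately show ?thesis by simp
qed

text \<open>By the Lindeloef property countably many chart images suffice. The empty chart is added so that
  they can be enumerated even when \<open>S\<close> is empty.\<close>

lemma surface_countable_charts:
  assumes "surface S"
  shows "\<exists>(U :: nat \<Rightarrow> (real^2) set) x. (\<forall>n. local_param S (U n) (x n)) \<and> S = (\<Union>n. x n ` U n)"
proof -
  define F where "F = {x ` U | U x. local_param S U x}"
  have "openin (top_of_set S) A" if "A \<in> F" for A
    using that by (auto simp: F_def local_param_def)
  then obtain F' where F': "F' \<subseteq> F" "countable F'" "\<Union>F' = \<Union>F"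
    using Lindelof_openin[of F S] by metis
  have SF: "\<Union>F = S"
  proof
    show "S \<subseteq> \<Union>F"
    proof
      fix p assume "p \<in> S"
      then obtain U x where "local_param S U x" "p \<in> x ` U"
        using assms unfolding surface_def by auto
      then show "p \<in> \<Union>F" unfolding F_def by auto
    qed
    show "\<Union>F \<subseteq> S"
    proof (rule Union_least)
      fix A assume "A \<in> F"
      then have "openin (top_of_set S) A" by (auto simp: F_def local_param_def)
      then show "A \<subseteq> S" by (rule openin_imp_subset)
    qed
  qed
  have "local_param S {} (\<lambda>_. 0)"
    by (auto simp: local_param_def smooth_on_def)
  then have "{} \<in> F" unfolding F_def by force
  define A where "A = from_nat_into (insert {} F')"
  have rA: "range A = insert {} F'"
    unfolding A_def by (rule range_from_nat_into) (use F'(2) in auto)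
  have "\<exists>U x. local_param S U x \<and> A n = x ` U" for n
  proof -
    have "A n \<in> F" using rA F'(1) \<open>{} \<in> F\<close> by (metis insert_subset rangeI subsetD)
    then show ?thesis by (auto simp: F_def)
  qed
  then obtain U x where Ux: "\<And>n. local_param S (U n) (x n)" "\<And>n. A n = x n ` U n" by metis
  have "S = \<Union>(range A)" using rA SF F'(3) by simp
  then show ?thesis using Ux by (intro exI[of _ U] exI[of _ x]) simp
qed

lemma local_param_image_borel:
  assumes "local_param S U x" "E \<in> sets borel" "E \<subseteq> U"
  shows "x ` E \<in> sets borel"
proof -
  obtain z where z: "smooth_on (x ` U) z" "\<And>q. q \<in> U \<Longrightarrow> z (x q) = q"
    using assms(1) unfolding local_param_def by auto
  have "z \<in> borel_measurable (restrict_space borel (x ` U))"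
    by (rule borel_measurable_continuous_on_restrict[OF smooth_on_imp_continuous_on[OF z(1)]])
  from measurable_sets[OF this assms(2)]
  have "z -` E \<inter> x ` U \<in> sets (restrict_space borel (x ` U))" by (simp add: space_restrict_space)
  moreover have "x ` U \<in> sets borel"
    by (rule continuous_image_sigma_compact_borel[OF _ local_param_continuous_on[OF assms(1)]])
      (use assms(1) in \<open>simp add: local_param_def\<close>)
  moreover have "z -` E \<inter> x ` U = x ` E" using z(2) assms(3) by force
  ultimately show ?thesis by (simp add: sets_restrict_space_iff)
qed

lemma surface_borel:
  assumes "surface S" shows "S \<in> sets borel"
proof -
  obtain U x where U0: "\<forall>n::nat. local_param S (U n) (x n)" and U2: "S = (\<Union>n. x n ` U n)"
    using surface_countable_charts[OF assms] by (elim exE conjE)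
  note U = U0[rule_format] U2
  have "x n ` U n \<in> sets borel" for n
    by (rule local_param_image_borel[OF U(1) local_param_domain_borel[OF U(1)] order_refl])
  then show ?thesis unfolding U(2) by (intro sets.countable_UN) auto
qed

text \<open>A Borel set is cut into countably many disjoint pieces, each inside one chart image, so the
  values of the measure on sets that lie in a chart image determine it.\<close>

lemma surface_measure_eqI:
  assumes S: "surface S"
    and M: "sets M = sets (restrict_space borel S)" and M': "sets M' = sets (restrict_space borel S)"
    and eq: "\<And>U x E. local_param S U x \<Longrightarrow> E \<in> sets borel \<Longrightarrow> E \<subseteq> U \<Longrightarrow>
      emeasure M (x ` E) = emeasure M' (x ` E)"
  shows "M = M'"
proof (rule measure_eqI)
  show "sets M = sets M'" using M M' by simp
  fix A assume "A \<in> sets M"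
  then have A: "A \<in> sets borel" "A \<subseteq> S"
    using M surface_borel[OF S] by (auto simp: sets_restrict_space_iff)
  obtain U x where U0: "\<forall>n::nat. local_param S (U n) (x n)" and U2: "S = (\<Union>n. x n ` U n)"
    using surface_countable_charts[OF S] by (elim exE conjE)
  note U = U0[rule_format] U2
  define B where "B n = A \<inter> x n ` U n" for n
  define C where "C = disjointed B"
  have "B n \<in> sets borel" for n
    unfolding B_def
    by (intro sets.Int A local_param_image_borel[OF U(1) local_param_domain_borel[OF U(1)] order_refl])
  then have Cb: "C n \<in> sets borel" for n
    unfolding C_def using sets.range_disjointed_sets[of B borel] by auto
  have Cs: "C n \<subseteq> B n" for n unfolding C_def by (rule disjointed_subset)
  have dis: "disjoint_family C" unfolding C_def by (rule disjoint_family_disjointed)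
  have UC: "(\<Union>n. C n) = A"
    unfolding C_def UN_disjointed_eq using A(2) U(2) by (auto simp: B_def)
  have CS: "C n \<in> sets (restrict_space borel S)" for n
  proof -
    have "C n \<subseteq> S" using Cs[of n] A(2) by (auto simp: B_def)
    then show ?thesis using Cb surface_borel[OF S] by (simp add: sets_restrict_space_iff)
  qed
  have "emeasure M (C n) = emeasure M' (C n)" for n
  proof -
    define E where "E = x n -` C n \<inter> U n"
    have "x n \<in> borel_measurable (restrict_space borel (U n))"
      by (rule borel_measurable_continuous_on_restrict[OF local_param_continuous_on[OF U(1)]])
    from measurable_sets[OF this Cb[of n]]
    have "E \<in> sets (restrict_space borel (U n))" by (simp add: space_restrict_space E_def)
    then have "E \<in> sets borel"
      using local_param_domain_borel[OF U(1)] by (simp add: sets_restrict_space_iff)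
    moreover have "E \<subseteq> U n" by (simp add: E_def)
    moreover have "x n ` E = C n" using Cs[of n] by (auto simp: E_def B_def)
    ultimately show ?thesis using eq[OF U(1)] by metis
  qed
  then have "(\<Sum>n. emeasure M (C n)) = (\<Sum>n. emeasure M' (C n))" by simp
  then show "emeasure M A = emeasure M' A"
    using suminf_emeasure[of C M] suminf_emeasure[of C M'] CS dis M M' UC by (auto simp: image_subset_iff)
qed

lemma local_param_derivative_continuous_on:
  assumes U: "local_param S U x"
  shows "continuous_on U (\<lambda>q. frechet_derivative x (at q within U) k)"
  unfolding continuous_on_eq_continuous_within
proof
  fix q assume q: "q \<in> U"
  have "smooth_on U x" and U': "openin (top_of_set half_plane) U"
    using U by (simp_all add: local_param_def)
  then obtain W g where W: "open W" "q \<in> W" "\<And>k. Ck_on k W g" "\<And>r. r \<in> W \<inter> U \<Longrightarrow> g r = x r"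
    using smooth_onE[OF _ q] by metis
  obtain d where d: "d > 0" "ball q d \<subseteq> W" using W openE by blast
  have eq: "frechet_derivative g (at r) k = frechet_derivative x (at r within U) k"
    if "r \<in> U" "dist r q < d" for r
  proof -
    have rW: "r \<in> W" using that d by (auto simp: dist_commute)
    obtain d' where d': "d' > 0" "ball r d' \<subseteq> W" using W(1) rW openE by blast
    have "(g has_derivative frechet_derivative g (at r)) (at r within U)"
      by (rule has_derivative_at_withinI[OF Ck_on_has_derivative[OF W(3) rW]])
    then have "(x has_derivative frechet_derivative g (at r)) (at r within U)"
    proof (rule has_derivative_transform_within[OF _ d'(1) that(1)])
      fix s assume "s \<in> U" "dist s r < d'"
      then show "g s = x s" using W(4)[of s] d'(2) by (auto simp: dist_commute)
    qed
    then show ?thesis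
      using half_plane_derivative_unique[OF U' that(1) _ local_param_has_derivative[OF U that(1)]] by metis
  qed
  have "isCont (\<lambda>r. frechet_derivative g (at r) k) q"
    using Ck_on_continuous[OF Ck_on_directional_derivative[OF W(3)]] W(1,2)
    by (simp add: continuous_on_eq_continuous_at)
  then have "continuous (at q within U) (\<lambda>r. frechet_derivative g (at r) k)"
    by (rule continuous_at_imp_continuous_at_within)
  then show "continuous (at q within U) (\<lambda>q. frechet_derivative x (at q within U) k)"
    by (rule continuous_transform_within[OF _ d(1) q]) (rule eq)
qed

lemma cross3_inner_cross3: "cross3 a b \<bullet> cross3 c d = (a \<bullet> c) * (b \<bullet> d) - (a \<bullet> d) * (b \<bullet> c)"
  by (simp add: cross3_simps)

context orthonormal_frame
begin

text \<open>The cross product of two tangent vectors is normal, and its component along \<open>e = cross3 t1 t2\<close>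
  is the determinant of their horizontal parts.\<close>

lemma norm_cross3_tangent:
  assumes n: "n \<bullet> n = 1" "n \<bullet> e > 0" and X: "n \<bullet> X = 0" and Y: "n \<bullet> Y = 0"
  shows "norm (cross3 X Y) * (n \<bullet> e) = \<bar>(X \<bullet> t1) * (Y \<bullet> t2) - (X \<bullet> t2) * (Y \<bullet> t1)\<bar>"
proof -
  define c where "c = cross3 X Y"
  define d where "d = c - (n \<bullet> c) *\<^sub>R n"
  have "cross3 n c = 0" using Lagrange[of n X Y] X Y by (simp add: c_def)
  then have "cross3 n d = 0" by (simp add: d_def Cross3.right_diff_distrib cross_mult_right)
  moreover have "n \<bullet> d = 0" by (simp add: d_def inner_diff_right n)
  ultimately have "norm n * norm d = 0" using norm_cross_dot[of n d] by simp
  then have "d = 0" using n by auto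
  then have c: "c = (n \<bullet> c) *\<^sub>R n" by (simp add: d_def)
  have "norm n = 1" using n by (simp add: norm_eq_1)
  then have "norm c = \<bar>n \<bullet> c\<bar>" using arg_cong[OF c, of norm] by simp
  moreover have "c \<bullet> e = (n \<bullet> c) * (n \<bullet> e)" using arg_cong[OF c, of "\<lambda>x. x \<bullet> e"] by simp
  moreover have "c \<bullet> e = (X \<bullet> t1) * (Y \<bullet> t2) - (X \<bullet> t2) * (Y \<bullet> t1)"
    using cross3_inner_cross3[of X Y t1 t2] by (simp add: c_def cross)
  ultimately show ?thesis using n by (simp add: c_def[symmetric] abs_mult)
qed

end

locale upward_graph_surface = graph_surface +
  assumes N_e_pos: "p \<in> S \<Longrightarrow> N p \<bullet> e > 0"
begin

lemma chart_area:
  assumes U: "local_param S U x" "q \<in> U"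
  defines "x' \<equiv> frechet_derivative x (at q within U)"
  shows "\<bar>det (matrix (\<lambda>k. proj (x' k)))\<bar> * inverse (gauss_param (proj (x q)) \<bullet> e) =
    norm (cross3 (x' (axis 1 1)) (x' (axis 2 1)))"
proof -
  have p: "x q \<in> S" using U openin_imp_subset unfolding local_param_def by blast
  have t: "N (x q) \<bullet> x' k = 0" for k
    unfolding x'_def by (rule N_tangent[OF p chart_derivative_tangent[OF U]])
  have "norm (cross3 (x' (axis 1 1)) (x' (axis 2 1))) * (N (x q) \<bullet> e) = \<bar>det (matrix (\<lambda>k. proj (x' k)))\<bar>"
    unfolding norm_cross3_tangent[OF norm_N[OF p] N_e_pos[OF p] t t]
    by (simp add: det_2 matrix_def mult.commute)
  then show ?thesis using N_e_pos[OF p] by (simp add: lift_proj[OF p] field_simps)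
qed

lemma borel_\<Omega>: "\<Omega> \<in> sets borel"
proof -
  obtain U x where U0: "\<forall>n::nat. local_param S (U n) (x n)" and U2: "S = (\<Union>n. x n ` U n)"
    using surface_countable_charts[OF surface] by (elim exE conjE)
  have "(\<lambda>q. proj (x n q)) ` U n \<in> sets borel" for n
  proof (rule continuous_image_sigma_compact_borel)
    show "openin (top_of_set half_plane) (U n)" using U0 by (simp add: local_param_def)
    show "continuous_on (U n) (\<lambda>q. proj (x n q))"
      using local_param_continuous_on[OF U0[rule_format]] 
      by (intro linear_continuous_on_compose[OF _ linear_proj])
  qed
  then have "(\<Union>n. (\<lambda>q. proj (x n q)) ` U n) \<in> sets borel" by (intro sets.countable_UN) auto
  moreover have "(\<Union>n. (\<lambda>q. proj (x n q)) ` U n) = \<Omega>"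
    unfolding proj_S[symmetric] U2 by auto
  ultimately show ?thesis by simp
qed

text \<open>For a unit normal this is \<open>sqrt (1 + |\<nabla>h|\<^sup>2)\<close>. Written with the Gauss map it is continuous on all of
  \<open>\<Omega>\<close>, also where \<open>h\<close> is only differentiable within \<open>\<Omega>\<close>.\<close>

definition area_density :: "real^2 \<Rightarrow> real" where
  "area_density y = inverse (gauss_param y \<bullet> e)"

lemma area_density_pos: "y \<in> \<Omega> \<Longrightarrow> 0 < area_density y"
  by (simp add: area_density_def N_e_pos lift_in_S)

lemma continuous_on_area_density: "continuous_on \<Omega> area_density"
  unfolding area_density_def[abs_def]
  by (intro continuous_intros smooth_on_imp_continuous_on smooth_on_gauss_param)
    (use N_e_nonzero lift_in_S in auto)

definition graph_area :: "(real^3) measure" where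
  "graph_area = distr (density (restrict_space lborel \<Omega>) (\<lambda>y. ennreal (area_density y)))
     (restrict_space borel S) (lift h)"

lemma measurable_restrict_\<Omega>:
  "continuous_on \<Omega> f \<Longrightarrow> f \<in> borel_measurable (restrict_space lborel \<Omega>)"
  using borel_measurable_continuous_on_restrict[of \<Omega> f]
  by (simp cong: measurable_cong_sets add: sets_restrict_space)

lemma measurable_lift: "lift h \<in> measurable (restrict_space lborel \<Omega>) (restrict_space borel S)"
  by (rule measurable_restrict_space2[OF _ measurable_restrict_\<Omega>[OF continuous_on_lift]])
    (simp add: lift_in_S space_restrict_space)

lemma measurable_area_density: "area_density \<in> borel_measurable (restrict_space lborel \<Omega>)"
  by (rule measurable_restrict_\<Omega>[OF continuous_on_area_density])

lemma emeasure_graph_area: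
  assumes U: "local_param S U x" and E: "E \<in> sets borel" "E \<subseteq> U"
  shows "emeasure graph_area (x ` E) =
    (\<integral>\<^sup>+ q\<in>E. ennreal (norm (cross3 (frechet_derivative x (at q within U) (axis 1 1))
        (frechet_derivative x (at q within U) (axis 2 1)))) \<partial>lborel)"
proof -
  let ?x' = "\<lambda>q. frechet_derivative x (at q within U)"
  let ?c = "\<lambda>q. norm (cross3 (?x' q (axis 1 1)) (?x' q (axis 2 1)))"
  define g where "g q = proj (x q)" for q
  have xS: "x q \<in> S" if "q \<in> U" for q
    using U that openin_imp_subset unfolding local_param_def by blast
  have xE: "x ` E \<in> sets (restrict_space borel S)"
    using local_param_image_borel[OF U E] surface_borel[OF surface] xS E(2)
    by (auto simp: sets_restrict_space_iff)
  have gE: "lift h -` (x ` E) \<inter> \<Omega> = g ` E"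
  proof (intro equalityI subsetI)
    fix y assume "y \<in> lift h -` (x ` E) \<inter> \<Omega>"
    then obtain q where "q \<in> E" "lift h y = x q" by auto
    then have "y = g q" by (metis g_def proj_lift)
    then show "y \<in> g ` E" using \<open>q \<in> E\<close> by simp
  qed (use lift_proj proj_in_\<Omega> xS E(2) in \<open>auto simp: g_def\<close>)
  have gE\<Omega>: "g ` E \<subseteq> \<Omega>" using gE by auto
  have "lift h -` (x ` E) \<inter> space (restrict_space lborel \<Omega>) \<in> sets (restrict_space lborel \<Omega>)"
    by (rule measurable_sets[OF measurable_lift xE])
  then have gEs: "g ` E \<in> sets (restrict_space lborel \<Omega>)" by (simp add: gE space_restrict_space)
  then have gEb: "g ` E \<in> sets borel" using borel_\<Omega> by (simp add: sets_restrict_space_iff)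
  have "emeasure graph_area (x ` E) =
    emeasure (density (restrict_space lborel \<Omega>) (\<lambda>y. ennreal (area_density y))) (g ` E)"
    unfolding graph_area_def using measurable_lift xE gE
    by (subst emeasure_distr) (simp_all add: space_restrict_space cong: measurable_cong_sets)
  also have "\<dots> = (\<integral>\<^sup>+y. ennreal (area_density y) * indicator (g ` E) y \<partial>restrict_space lborel \<Omega>)"
    by (rule emeasure_density) (use measurable_area_density gEs in auto)
  also have "\<dots> = (\<integral>\<^sup>+y. ennreal (area_density y) * indicator (g ` E) y * indicator \<Omega> y \<partial>lborel)"
    by (rule nn_integral_restrict_space) (simp add: borel_\<Omega>)
  also have "\<dots> = (\<integral>\<^sup>+y. ennreal (area_density y) * indicator (g ` E) y \<partial>lebesgue)"
    unfolding nn_integral_completion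
    by (rule nn_integral_cong) (use gE\<Omega> in \<open>auto simp: indicator_def\<close>)
  also have "\<dots> = (\<integral>\<^sup>+q. ennreal (\<bar>det (matrix (\<lambda>k. proj (?x' q k)))\<bar> * area_density (g q)) * indicator E q \<partial>lebesgue)"
  proof (rule nn_integral_change_of_variables)
    show "E \<in> sets lebesgue" using E(1) by (simp add: sets_completionI_sets)
    show "(g has_derivative (\<lambda>k. proj (?x' q k))) (at q within E)" if "q \<in> E" for q
      unfolding g_def[abs_def]
      by (rule has_derivative_subset[OF bounded_linear.has_derivative[OF bounded_linear_proj
              local_param_has_derivative[OF U]] E(2)]) (use that E(2) in auto)
    show "inj_on g E"
    proof (rule inj_onI)
      fix q r assume qr: "q \<in> E" "r \<in> E" "g q = g r"
      obtain z where z: "\<And>q. q \<in> U \<Longrightarrow> z (x q) = q" using U unfolding local_param_def by auto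
      have "x q = x r" using qr lift_proj xS E(2) unfolding g_def by (metis subsetD)
      then show "q = r" using z qr E(2) by (metis subsetD)
    qed
    have "(\<lambda>y. indicator (g ` E) y *\<^sub>R area_density y) \<in> borel_measurable borel"
      by (rule borel_measurable_continuous_on_indicator[OF gEb
            continuous_on_subset[OF continuous_on_area_density gE\<Omega>]])
    then show "(\<lambda>y. indicator (g ` E) y * area_density y) \<in> borel_measurable lebesgue"
      by (intro measurable_completion) simp
    have "continuous_on E ?c"
      by (intro continuous_on_norm continuous_on_cross
          continuous_on_subset[OF local_param_derivative_continuous_on[OF U] E(2)])
    then have "(\<lambda>q. indicator E q *\<^sub>R ?c q) \<in> borel_measurable borel"
      by (rule borel_measurable_continuous_on_indicator[OF E(1)])
    also have "(\<lambda>q. indicator E q *\<^sub>R ?c q) =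
        (\<lambda>q. indicator E q * (\<bar>det (matrix (\<lambda>k. proj (?x' q k)))\<bar> * area_density (g q)))"
      using chart_area[OF U] E(2) by (auto simp: fun_eq_iff indicator_def area_density_def g_def)
    finally show "(\<lambda>q. indicator E q * (\<bar>det (matrix (\<lambda>k. proj (?x' q k)))\<bar> * area_density (g q)))
        \<in> borel_measurable lebesgue"
      by (intro measurable_completion) simp
    show "0 \<le> area_density y" if "y \<in> g ` E" for y
      using area_density_pos gE\<Omega> that by (meson less_imp_le subsetD)
  qed
  also have "\<dots> = (\<integral>\<^sup>+ q\<in>E. ennreal (?c q) \<partial>lborel)"
    unfolding nn_integral_completion
    by (rule nn_integral_cong)
      (use chart_area[OF U] E(2) in \<open>auto simp: indicator_def area_density_def g_def\<close>)
  finally show ?thesis .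
qed

lemma area_measure_eq: "area_measure S = graph_area"
  unfolding area_measure_def
proof (rule the_equality, intro conjI allI impI)
  show sets: "sets graph_area = sets (restrict_space borel S)" by (simp add: graph_area_def)
  fix M :: "(real^3) measure"
  assume M: "sets M = sets (restrict_space borel S) \<and>
    (\<forall>U x E. local_param S U x \<and> E \<in> sets borel \<and> E \<subseteq> U \<longrightarrow> emeasure M (x ` E) =
      (\<integral>\<^sup>+ q\<in>E. ennreal (norm (cross3 (frechet_derivative x (at q within U) (axis 1 1))
        (frechet_derivative x (at q within U) (axis 2 1)))) \<partial>lborel))"
  show "M = graph_area"
    by (rule surface_measure_eqI[OF surface _ sets]) (use M emeasure_graph_area in auto)
qed (rule emeasure_graph_area; auto)

lemma
  fixes F :: "real^3 \<Rightarrow> real"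
  assumes F: "integrable (weighted_area v S) F"
  shows integrable_weighted_area:
      "integrable (restrict_space lborel \<Omega>) (\<lambda>y. F (lift h y) * (exp (lift h y \<bullet> v) * area_density y))"
    and integral_weighted_area: "(LINT p|weighted_area v S. F p) =
      (LINT y|restrict_space lborel \<Omega>. F (lift h y) * (exp (lift h y \<bullet> v) * area_density y))"
proof -
  have meas: "F \<in> borel_measurable (restrict_space borel S)"
    using borel_measurable_integrable[OF F]
    by (simp add: weighted_area_def area_measure_eq graph_area_def cong: measurable_cong_sets)
  have exp_meas: "(\<lambda>p. exp (p \<bullet> v)) \<in> borel_measurable (restrict_space borel S)"
    by (intro borel_measurable_continuous_on_restrict continuous_intros)
  have G: "(\<lambda>p. exp (p \<bullet> v) *\<^sub>R F p) \<in> borel_measurable (restrict_space borel S)"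
    using meas exp_meas by simp
  define M where "M = density (restrict_space lborel \<Omega>) (\<lambda>y. ennreal (area_density y))"
  have liftM: "lift h \<in> measurable M (restrict_space borel S)"
    unfolding M_def using measurable_lift by (simp cong: measurable_cong_sets)
  have wpos: "AE y in restrict_space lborel \<Omega>. 0 \<le> area_density y"
    by (rule AE_I2) (simp add: space_restrict_space less_imp_le area_density_pos)
  have comp: "(\<lambda>y. exp (lift h y \<bullet> v) *\<^sub>R F (lift h y)) \<in> borel_measurable (restrict_space lborel \<Omega>)"
    by (rule measurable_compose[OF measurable_lift G])
  have W: "weighted_area v S = density (distr M (restrict_space borel S) (lift h)) (\<lambda>p. ennreal (exp (p \<bullet> v)))"
    by (simp add: weighted_area_def area_measure_eq graph_area_def M_def)
  have eq: "area_density y *\<^sub>R (exp (lift h y \<bullet> v) *\<^sub>R F (lift h y)) =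
    F (lift h y) * (exp (lift h y \<bullet> v) * area_density y)" for y by simp
  have "integrable (distr M (restrict_space borel S) (lift h)) (\<lambda>p. exp (p \<bullet> v) *\<^sub>R F p)"
    using F unfolding W
    by (subst (asm) integrable_density) (use meas exp_meas in \<open>simp_all cong: measurable_cong_sets\<close>)
  then have "integrable M (\<lambda>y. exp (lift h y \<bullet> v) *\<^sub>R F (lift h y))"
    by (subst (asm) integrable_distr_eq[OF liftM G])
  then show "integrable (restrict_space lborel \<Omega>) (\<lambda>y. F (lift h y) * (exp (lift h y \<bullet> v) * area_density y))"
    unfolding M_def
    by (subst (asm) integrable_density[OF comp measurable_area_density wpos]) (simp only: eq)
  have "(LINT p|weighted_area v S. F p) =
      (LINT p|distr M (restrict_space borel S) (lift h). exp (p \<bullet> v) *\<^sub>R F p)"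
    unfolding W
    by (rule integral_density) (use meas exp_meas in \<open>simp_all cong: measurable_cong_sets\<close>)
  also have "\<dots> = (LINT y|M. exp (lift h y \<bullet> v) *\<^sub>R F (lift h y))"
    by (rule integral_distr[OF liftM G])
  also have "\<dots> = (LINT y|restrict_space lborel \<Omega>. F (lift h y) * (exp (lift h y \<bullet> v) * area_density y))"
    unfolding M_def integral_density[OF comp measurable_area_density wpos] eq ..
  finally show "(LINT p|weighted_area v S. F p) =
      (LINT y|restrict_space lborel \<Omega>. F (lift h y) * (exp (lift h y \<bullet> v) * area_density y))" .
qed

end

section \<open>Stability\<close>

context upward_graph_surface
begin

lemma second_variation_nonneg:
  assumes soliton: "\<And>p. p \<in> S \<Longrightarrow> mean_curvature S N p = N p \<bullet> v + l"
    and f: "test_function S f"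
  shows "0 \<le> second_variation v S N f"
proof (cases "integrable (weighted_area v S)
    (\<lambda>p. (norm (surface_gradient S f p))\<^sup>2 - sff_norm_sq S N p * (f p)\<^sup>2)")
  \<comment> \<open>The integral of a function that is not integrable is zero by convention.\<close>
  case False
  then show ?thesis by (simp add: second_variation_def not_integrable_integral_eq)
next
  case True
  let ?R = "restrict_space lborel \<Omega>"
  define J where "J y = ((norm (surface_gradient S f (lift h y)))\<^sup>2 -
      sff_norm_sq S N (lift h y) * (f (lift h y))\<^sup>2) * (exp (lift h y \<bullet> v) * area_density y)" for y
  define u where "u y = f (lift h y)" for y
  define X where "X t y = (if y \<in> interior \<Omega> then flux v h gauss_param u t y else 0)" for t y
  note Xdef = X_def[abs_def, unfolded u_def[abs_def]]
  define d where "d y = partial 1 (X t1) y + partial 2 (X t2) y" for y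
  have smu: "smooth_on \<Omega> u" unfolding u_def[abs_def]
    by (rule smooth_on_compose[of S])
      (use f smooth_on_lift[OF smooth_h] lift_in_S in \<open>auto simp: test_function_def\<close>)
  have CkX: "Ck_on (Suc 0) UNIV (X t)" for t
    unfolding Xdef by (rule Ck_on_flux_extension[OF f])
  have X0: "frechet_derivative (X t) (at y) k = 0" if "y \<notin> interior \<Omega>" for t y k
    unfolding Xdef by (rule flux_extension_derivative_outside[OF f that])
  have int: "integrable lborel (\<lambda>y. partial i (X t) y)"
    and int0: "(LINT y|lborel. partial i (X t) y) = 0" for i t
  proof -
    have "\<exists>K. compact K \<and> (\<forall>y. y \<notin> K \<longrightarrow> X t y = 0)"
      unfolding Xdef by (rule flux_extension_compact_support[OF f])
    then obtain K where K: "compact K" "\<And>y. y \<notin> K \<Longrightarrow> X t y = 0" by blast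
    show "integrable lborel (\<lambda>y. partial i (X t) y)"
      by (rule integrable_directional_derivative[OF CkX K])
    show "(LINT y|lborel. partial i (X t) y) = 0"
      by (rule integral_directional_derivative_eq_0[OF CkX K])
  qed
  have intd: "integrable lborel d" "(LINT y|lborel. d y) = 0"
    unfolding d_def[abs_def] using int int0 by simp_all
  have ind: "(\<lambda>y. indicator \<Omega> y *\<^sub>R d y) = d"
  proof -
    have "d y = 0" if "y \<notin> \<Omega>" for y
    proof -
      have "y \<notin> interior \<Omega>" using interior_subset_\<Omega> that by blast
      then show ?thesis by (simp add: d_def X0)
    qed
    then show ?thesis by (auto simp: fun_eq_iff indicator_def)
  qed
  have \<Omega>: "\<Omega> \<inter> space lborel \<in> sets lborel" using borel_\<Omega> by simp
  have "integrable ?R d" "(LINT y|?R. d y) = 0"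
    using intd unfolding integrable_restrict_space[OF \<Omega>] integral_restrict_space[OF \<Omega>] ind by auto
  \<comment> \<open>On \<open>\<Omega> - interior \<Omega>\<close>, where the flux has derivative zero, the curvature term drops out
    because the test function vanishes there.\<close>
  have le: "d y \<le> J y" if y: "y \<in> \<Omega>" for y
  proof (cases "y \<in> interior \<Omega>")
    case True
    have "frechet_derivative (X t) (at y) = frechet_derivative (flux v h gauss_param u t) (at y)" for t
      by (rule frechet_derivative_transform_within_open[where X = "interior \<Omega>"])
        (use CkX True in \<open>auto simp: X_def\<close>)
    then have "d y = partial 1 (flux v h gauss_param u t1) y + partial 2 (flux v h gauss_param u t2) y"
      by (simp add: d_def)
    also have "\<dots> \<le> ((norm (surface_gradient S f (lift h y)))\<^sup>2 -
        sff_norm_sq S N (lift h y) * (f (lift h y))\<^sup>2) * (exp (lift h y \<bullet> v) / (N (lift h y) \<bullet> e))"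
      by (rule divergence_flux_le[OF soliton True N_e_pos[OF lift_in_S[OF y]] smu]) (simp_all add: u_def)
    finally show ?thesis by (simp add: J_def area_density_def divide_inverse)
  next
    case False
    have "f (lift h y) = 0"
      using f lift_in_boundary[OF y False] by (simp add: test_function_def)
    then have "0 \<le> J y" using area_density_pos[OF y] by (simp add: J_def)
    moreover have "d y = 0" using X0[OF False] by (simp add: d_def)
    ultimately show ?thesis by simp
  qed
  have "0 = (LINT y|?R. d y)" by (simp add: \<open>(LINT y|?R. d y) = 0\<close>)
  also have "\<dots> \<le> (LINT y|?R. J y)"
  proof (rule integral_mono)
    show "integrable ?R d" by fact
    show "integrable ?R J" unfolding J_def[abs_def] by (rule integrable_weighted_area[OF True])
    show "d y \<le> J y" if "y \<in> space ?R" for y using that le by (simp add: space_restrict_space)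
  qed
  also have "\<dots> = second_variation v S N f"
    unfolding second_variation_def J_def[abs_def] by (rule integral_weighted_area[OF True, symmetric])
  finally show ?thesis .
qed

end

lemma graph_over_plane:
  fixes f :: "real^3 \<Rightarrow> real"
  assumes S: "surface S" "gauss_map S N" and e: "norm e = 1"
    and D: "D \<subseteq> {q. e \<bullet> q = c}" and f: "smooth_on D f" and SD: "S = (\<lambda>q. q + f q *\<^sub>R e) ` D"
  shows "\<exists>t1 t2 \<Omega> h. graph_surface t1 t2 e S N \<Omega> h"
proof -
  obtain t1 t2 where "orthonormal_frame t1 t2 e" using orthonormal_frame_exists[OF e] by blast
  then interpret orthonormal_frame t1 t2 e .
  define flat where "flat = lift (\<lambda>_. c)"
  define \<Omega> where "\<Omega> = proj ` D"
  define h where "h y = c + f (flat y)" for y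
  have flat: "flat (proj q) = q" if "q \<in> D" for q
    unfolding flat_def using D that by (intro proj_eq_lift) (auto simp: inner_commute)
  have "smooth_on \<Omega> flat"
    unfolding flat_def by (intro smooth_on_lift smooth_on_if_Ck_on[OF open_UNIV]) (auto intro: Ck_on_const)
  then have "smooth_on \<Omega> (\<lambda>y. f (flat y))"
    by (rule smooth_on_compose[OF f]) (auto simp: \<Omega>_def flat)
  then have "smooth_on \<Omega> h"
    unfolding h_def[abs_def]
    by (intro smooth_on_add smooth_on_if_Ck_on[OF open_UNIV, of "\<lambda>_. c"]) (auto intro: Ck_on_const)
  moreover have "lift h (proj q) = q + f q *\<^sub>R e" if "q \<in> D" for q
  proof -
    have "lift h (proj q) = flat (proj q) + f (flat (proj q)) *\<^sub>R e"
      by (simp add: lift_def flat_def h_def scaleR_add_left)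
    then show ?thesis by (simp add: flat[OF that])
  qed
  then have "S = lift h ` \<Omega>" unfolding SD \<Omega>_def by (simp add: image_image)
  ultimately have "graph_surface t1 t2 e S N \<Omega> h" using S by unfold_locales
  then show ?thesis by blast
qed

text \<open>A continuous function without zeros on a connected set has constant sign. Where the sign is
  negative, the plane can be described by \<open>- e\<close> instead of \<open>e\<close>, so \<open>N \<bullet> e > 0\<close> may be assumed.\<close>

lemma gauss_map_sign:
  fixes f :: "real^3 \<Rightarrow> real"
  assumes S: "surface S" "gauss_map S N" and e: "norm e = 1" and conn: "connected D"
    and D: "D \<subseteq> {q. e \<bullet> q = c}" and f: "smooth_on D f" and SD: "S = (\<lambda>q. q + f q *\<^sub>R e) ` D"
  shows "(\<forall>p\<in>S. N p \<bullet> e > 0) \<or> (\<forall>p\<in>S. N p \<bullet> e < 0)"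
proof -
  obtain t1 t2 \<Omega> h where "graph_surface t1 t2 e S N \<Omega> h"
    using graph_over_plane[OF S e D f SD] by blast
  then interpret graph_surface t1 t2 e S N \<Omega> h .
  have "continuous_on D (\<lambda>q. q + f q *\<^sub>R e)"
    by (intro continuous_intros smooth_on_imp_continuous_on f)
  then have "connected S" unfolding SD by (rule connected_continuous_image[OF _ conn])
  moreover have "continuous_on S (\<lambda>p. N p \<bullet> e)"
    using gauss by (intro continuous_intros smooth_on_imp_continuous_on) (simp add: gauss_map_def)
  ultimately have con: "connected ((\<lambda>p. N p \<bullet> e) ` S)" by (intro connected_continuous_image)
  show ?thesis
  proof (rule ccontr)
    assume "\<not> ?thesis"
    then obtain p q where pq: "p \<in> S" "q \<in> S" "N p \<bullet> e \<le> 0" "0 \<le> N q \<bullet> e" by force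
    then have "0 \<in> (\<lambda>p. N p \<bullet> e) ` S"
      using connected_contains_Icc[OF con, of "N p \<bullet> e" "N q \<bullet> e"] by auto
    then show False using N_e_nonzero by auto
  qed
qed

theorem theorem3p3:
  fixes v :: "real^3" and l :: real and S :: "(real^3) set" and N :: "real^3 \<Rightarrow> real^3"
  assumes "norm v = 1"
    and "translating_soliton v l S N"
    and "graphical S"
  shows "strongly_stable v S N"
proof -
  have S: "surface S" "gauss_map S N" and H: "\<And>p. p \<in> S \<Longrightarrow> mean_curvature S N p = N p \<bullet> v + l"
    using assms(2) by (simp_all add: translating_soliton_def)
  have upward: "strongly_stable v S N"
    if e: "norm e = 1" and D: "D \<subseteq> {q. e \<bullet> q = c}" and f: "smooth_on D f"
      and SD: "S = (\<lambda>q. q + f q *\<^sub>R e) ` D" and pos: "\<forall>p\<in>S. N p \<bullet> e > 0"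
    for e c D and f :: "real^3 \<Rightarrow> real"
  proof -
    obtain t1 t2 \<Omega> h where "graph_surface t1 t2 e S N \<Omega> h"
      using graph_over_plane[OF S e D f SD] by blast
    then interpret upward_graph_surface t1 t2 e S N \<Omega> h
      using pos by (simp add: upward_graph_surface_def upward_graph_surface_axioms_def)
    show ?thesis unfolding strongly_stable_def using second_variation_nonneg[OF H] by blast
  qed
  obtain e c W D and f :: "real^3 \<Rightarrow> real" where e: "norm e = 1"
    and W: "openin (top_of_set {q. e \<bullet> q = c}) W" "connected W"
    and WD: "W \<subseteq> D" "D \<subseteq> closure W" and f: "smooth_on D f" and SD: "S = (\<lambda>q. q + f q *\<^sub>R e) ` D"
    using assms(3) unfolding graphical_def by blast
  have "closure W \<subseteq> {q. e \<bullet> q = c}"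
    by (rule closure_minimal[OF openin_imp_subset[OF W(1)] closed_hyperplane])
  then have D: "D \<subseteq> {q. e \<bullet> q = c}" using WD(2) by blast
  have "connected D" by (rule connected_intermediate_closure[OF W(2) WD])
  from gauss_map_sign[OF S e this D f SD] show ?thesis
  proof
    assume "\<forall>p\<in>S. N p \<bullet> e > 0"
    then show ?thesis by (rule upward[OF e D f SD])
  next
    assume neg: "\<forall>p\<in>S. N p \<bullet> e < 0"
    have "smooth_on D (\<lambda>q. - 1 * f q)"
      by (rule smooth_on_bilinear[OF smooth_on_if_Ck_on[OF open_UNIV] f bounded_bilinear_mult])
        (auto intro: Ck_on_const)
    then have f': "smooth_on D (\<lambda>q. - f q)" by simp
    show ?thesis
      by (rule upward[OF _ _ f', of "- e" "- c"]) (use e D SD neg in auto)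
  qed
qed

end
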